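(* Let $\{\mathcal{X},p(y|x),\mathcal{Y}\}$ be a discrete memoryless channel whose input alphabet is the $M$-ASK alphabet $\mathcal{X}=\{-M+1,-M+3,\dots,M-1\}$ with $M=2^{m+1}$, $m\ge 1$. Let $\mathcal{S}=\{-1,+1\}$, $\mathcal{A}=\{1,3,\dots,M-1\}$, and let $f:\{0,1\}^m\to\mathcal{A}$ be a bijection (amplitude labeling). For a probability distribution $p(\boldsymbol{b})=p(b_1,\dots,b_m)$ on $\{0,1\}^m$, let $\boldsymbol{B}=(B_1,\dots,B_m)\sim p(\boldsymbol{b})$, let $S$ be uniform on $\mathcal{S}$ and independent of $\boldsymbol{B}$, let $X=S\,f(\boldsymbol{B})$, whose distribution is identified with $p(x)=p(s,b_1,\dots,b_m)$, and let $Y$ be the channel output when $X$ is the channel input. Put $$R_{\mathrm{BMD}}(p(x))=H(S,B_1,\dots,B_m)-H(S|Y)-\sum_{i=1}^m H(B_i|Y).$$ Then the rate $$R_{\mathrm{BMD}}^{\gamma>0}=\max_{p(\boldsymbol{b}),\,\gamma:\ H(\boldsymbol{B})+\gamma\le R_{\mathrm{BMD}}(p(x))} \big(H(\boldsymbol{B})+\gamma\big),$$ where $\gamma$ ranges over $0<\gamma<1$ (the maximum being read as a supremum if it is not attained, and the constraint set being assumed nonempty), is achievable with amplitude shaping and modified sign-coding, using bit-metric decoding (BMD).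
   Context: Conventions. Logarithms are base 2 and entropies are in bits. The output alphabet $\mathcal{Y}$ is discrete and all entropies involved are finite (automatic if $\mathcal{Y}$ is finite). The channel is memoryless: $p(\underline{y}|\underline{x})=\prod_{i=1}^n p(y_i|x_i)$. Underlined letters denote length-$n$ sequences (unless another length is indicated), and $\otimes$ is element-wise multiplication. Typical sets. Let $(X_1,\dots,X_k)$ be discrete random variables with joint distribution $p(x_1,\dots,x_k)$, and let $\varepsilon>0$. The weakly jointly typical set $\mathcal{A}^n_\varepsilon(X_1\cdots X_k)$ is the set of tuples $(\underline{x}_1,\dots,\underline{x}_k)$ of length-$n$ sequences such that, for every nonempty $J\subseteq\{1,\dots,k\}$, $\left|-\frac1n\log p(\underline{x}_J)-H(X_J)\right|\le\varepsilon$, where $\underline{x}_J=(\underline{x}_j)_{j\in J}$, $X_J=(X_j)_{j\in J}$, and $p(\underline{x}_J)$ is the $n$-fold product of the marginal distribution of $X_J$. $\mathcal{B}$-typical set. For discrete random variables $(U,V)$, possibly composite, with $p(u,v)=p(u)p(v|u)$, define $$\mathcal{B}^n_{V,\varepsilon}(U)=\Big\{\underline{u}:\ \underline{u}\in\mathcal{A}^n_\varepsilon(U)\ \text{and}\ \Pr\{(\underline{u},\underline{V})\in\mathcal{A}^n_\varepsilon(UV)\mid \underline{U}=\underline{u}\}\ge 1-\varepsilon\Big\},$$ where, given $\underline{U}=\underline{u}$, $\underline{V}$ has distribution $\prod_i p(v_i|u_i)$. When $U$ or $V$ is composite, the typicality conditions are those of the collection of its components: $\mathcal{B}^n_{SY,\varepsilon}(B_1\cdots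 B_m)$ is the case $U=(B_1,\dots,B_m)$, $V=(S,Y)$, with $\mathcal{A}^n_\varepsilon(U)=\mathcal{A}^n_\varepsilon(B_1\cdots B_m)$ and $\mathcal{A}^n_\varepsilon(UV)=\mathcal{A}^n_\varepsilon(B_1\cdots B_m S Y)$. Modified sign-coding encoder with BMD. Its parameters are a distribution $p(\boldsymbol{b})$ on $\{0,1\}^m$ (which determines the joint distribution of $(\boldsymbol{B},S,Y)$ with $S$ uniform and independent of $\boldsymbol{B}$), a number $\gamma\in(0,1)$, a number $\varepsilon>0$, and a blocklength $n$. Put $n_1=\gamma n$ (rounded down to an integer if necessary, with $n_1>0$) and $n_2=n-n_1$. The messages $m_a\in\{1,\dots,M_a\}$ and $m_s\in\{1,\dots,M_s\}$, $M_s=2^{n_1}$, are uniform and independent. A shaping layer maps $m_a$ one-to-one to an $m$-tuple of binary sequences $\underline{\boldsymbol{b}}(m_a)=(\underline{b}_1(m_a),\dots,\underline{b}_m(m_a))\in\mathcal{B}^n_{SY,\varepsilon}(B_1\cdots B_m)$; applying $f$ symbol-wise gives the amplitude sequence $\underline{a}(m_a)\in\mathcal{A}^n$. The message $m_s$ is mapped bijectively to a sign sequence part $\underline{s}'(m_s)\in\mathcal{S}^{n_1}$. A coding layer assigns to each $(m_a,m_s)$ a second sign sequence part $\underline{s}''(m_a,m_s)\in\mathcal{S}^{n_2}$ (a function of $\underline{a}(m_a)$ and $\underline{s}'(m_s)$). With $\underline{s}(m_a,m_s)=(\underline{s}'(m_s),\underline{s}''(m_a,m_s))$, the transmitted sequence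 is $\underline{x}(m_a,m_s)=\underline{a}(m_a)\otimes\underline{s}(m_a,m_s)$. BMD. Upon receiving $\underline{y}$, the decoder outputs the unique index pair $(\hat m_a,\hat m_s)$ such that $(\underline{s}(\hat m_a,\hat m_s),\underline{y})\in\mathcal{A}^n_\varepsilon(SY)$ and $(\underline{b}_j(\hat m_a),\underline{y})\in\mathcal{A}^n_\varepsilon(B_jY)$ for every $j=1,\dots,m$; if there is no such unique pair, an error is declared. The error probability is $P_e=\Pr\{(\hat m_a,\hat m_s)\ne(m_a,m_s)\}$. Achievability. A rate $R$ is achievable (with modified sign-coding, using BMD) if for every $\delta>0$ and all $n$ large enough there exists a modified sign-coding encoder of blocklength $n$ (that is, a distribution $p(\boldsymbol{b})$ on $\{0,1\}^m$, numbers $\gamma\in(0,1)$ and $\varepsilon>0$, an integer $M_a\ge 1$ and $M_s=2^{n_1}$, a one-to-one map $m_a\mapsto\underline{\boldsymbol{b}}(m_a)\in\mathcal{B}^n_{SY,\varepsilon}(B_1\cdots B_m)$ with $\underline{a}(m_a)$ obtained by applying $f$ symbol-wise, a bijection $m_s\mapsto\underline{s}'(m_s)\in\mathcal{S}^{n_1}$, and sign sequence parts $\underline{s}''(m_a,m_s)\in\mathcal{S}^{n_2}$) such that, when $\underline{x}(m_a,m_s)=\underline{a}(m_a)\otimes\underline{s}(m_a,m_s)$ is transmitted and the decoder is the BMD decoder that outputs the unique $(\hat m_a,\hat m_s)$ with $(\underline{s}(\hat m_a,\hat m_s),\underline{y})\in\mathcal{A}^n_\varepsilon(SY)$ and $(\underline{b}_j(\hat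 m_a),\underline{y})\in\mathcal{A}^n_\varepsilon(B_jY)$ for every $j=1,\dots,m$, for the same $p(\boldsymbol{b})$ and $\varepsilon$, one has $\frac1n\log_2(M_aM_s)\ge R-\delta$ and $P_e\le\delta$. *)

theory Defs
  imports "HOL-Probability.Probability"
begin

text \<open>
  A collection of discrete random variables is given by a joint sample space with law
  \<open>P :: 'o pmf\<close> and a family \<open>X :: 'k \<Rightarrow> 'o \<Rightarrow> 'v\<close>; a subcollection is a finite set of indices
  \<open>J :: 'k set\<close>. Its value is a function that is \<^const>\<open>undefined\<close> outside \<open>J\<close>.
\<close>

definition joint_rv :: "('k \<Rightarrow> 'o \<Rightarrow> 'v) \<Rightarrow> 'k set \<Rightarrow> 'o \<Rightarrow> ('k \<Rightarrow> 'v)" where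
  "joint_rv X J \<omega> = (\<lambda>k\<in>J. X k \<omega>)"

definition joint_law :: "'o pmf \<Rightarrow> ('k \<Rightarrow> 'o \<Rightarrow> 'v) \<Rightarrow> 'k set \<Rightarrow> ('k \<Rightarrow> 'v) pmf" where
  "joint_law P X J = map_pmf (joint_rv X J) P"

text \<open>
  Discrete entropy is the library's entropy with respect to counting measure. The set
  \<open>J \<rightarrow>\<^sub>E UNIV\<close> is countable for finite \<open>J\<close> and countable \<open>'v\<close>, whereas the type \<open>'k \<Rightarrow> 'v\<close>
  need not be.
\<close>

definition joint_entropy :: "'o pmf \<Rightarrow> ('k \<Rightarrow> 'o \<Rightarrow> 'v::countable) \<Rightarrow> 'k set \<Rightarrow> real" where
  "joint_entropy P X J =
     prob_space.entropy (measure_pmf P) 2 (count_space (J \<rightarrow>\<^sub>E UNIV)) (joint_rv X J)"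

definition cond_entropy :: "'o pmf \<Rightarrow> ('o \<Rightarrow> 'v::countable) \<Rightarrow> ('o \<Rightarrow> 'v) \<Rightarrow> real" where
  "cond_entropy P U V =
     prob_space.conditional_entropy (measure_pmf P) 2 (count_space UNIV) (count_space UNIV) U V"

definition finite_joint_entropy :: "'o pmf \<Rightarrow> ('k \<Rightarrow> 'o \<Rightarrow> 'v::countable) \<Rightarrow> 'k set \<Rightarrow> bool" where
  "finite_joint_entropy P X J \<longleftrightarrow>
     information_space.finite_entropy (measure_pmf P) 2 (count_space (J \<rightarrow>\<^sub>E UNIV))
       (joint_rv X J) (pmf (joint_law P X J))"

definition seq_prob :: "'o pmf \<Rightarrow> ('k \<Rightarrow> 'o \<Rightarrow> 'v) \<Rightarrow> 'k set \<Rightarrow> nat \<Rightarrow> ('k \<Rightarrow> 'v list) \<Rightarrow> real" where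
  "seq_prob P X J n x = (\<Prod>i<n. pmf (joint_law P X J) (\<lambda>k\<in>J. x k ! i))"

text \<open>
  The typical set of the collection \<open>K\<close>: \<open>x k\<close> is the sequence belonging to variable \<open>k\<close>, and
  the sequences \<open>x k\<close> with \<open>k \<notin> K\<close> are irrelevant. Positivity of the probability has to be
  demanded explicitly because \<open>log 2 0 = 0\<close> here, whereas \<open>- log 0 = \<infinity>\<close> in the usual convention.
\<close>

definition typical_set ::
    "'o pmf \<Rightarrow> ('k \<Rightarrow> 'o \<Rightarrow> 'v::countable) \<Rightarrow> 'k set \<Rightarrow> nat \<Rightarrow> real \<Rightarrow> ('k \<Rightarrow> 'v list) set" where
  "typical_set P X K n \<epsilon> =
     {x. (\<forall>k\<in>K. length (x k) = n) \<and>
         (\<forall>J. J \<subseteq> K \<and> J \<noteq> {} \<longrightarrow>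
            0 < seq_prob P X J n x \<and>
            \<bar>- (1 / real n) * log 2 (seq_prob P X J n x) - joint_entropy P X J\<bar> \<le> \<epsilon>)}"

text \<open>
  The law of \<open>n\<close> independent samples in which sample \<open>i\<close> is conditioned on the variables in \<open>U\<close>
  having the values \<open>u k ! i\<close>. The conditioning events have positive probability whenever \<open>u\<close>
  is typical for \<open>U \<noteq> {}\<close>.
\<close>

definition cond_samples ::
    "'o pmf \<Rightarrow> ('k \<Rightarrow> 'o \<Rightarrow> 'v) \<Rightarrow> 'k set \<Rightarrow> nat \<Rightarrow> ('k \<Rightarrow> 'v list) \<Rightarrow> (nat \<Rightarrow> 'o) pmf" where
  "cond_samples P X U n u =
     Pi_pmf {..<n} undefined (\<lambda>i. cond_pmf P {\<omega>. \<forall>k\<in>U. X k \<omega> = u k ! i})"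

definition B_typical_set ::
    "'o pmf \<Rightarrow> ('k \<Rightarrow> 'o \<Rightarrow> 'v::countable) \<Rightarrow> 'k set \<Rightarrow> 'k set \<Rightarrow> nat \<Rightarrow> real \<Rightarrow> ('k \<Rightarrow> 'v list) set"
  where
  "B_typical_set P X U V n \<epsilon> =
     {u \<in> typical_set P X U n \<epsilon>.
        measure_pmf.prob (cond_samples P X U n u)
          {\<omega>. (\<lambda>k. if k \<in> U then u k else map (\<lambda>i. X k (\<omega> i)) [0..<n])
               \<in> typical_set P X (U \<union> V) n \<epsilon>} \<ge> 1 - \<epsilon>}"

definition ask_alphabet :: "nat \<Rightarrow> int set" where
  "ask_alphabet M = {- int M + 1 + 2 * int k | k. k < M}"

definition amplitudes :: "nat \<Rightarrow> int set" where
  "amplitudes M = {2 * int k + 1 | k. 2 * k + 1 < M}"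

definition signs :: "int set" where
  "signs = {-1, 1}"

lemma sign_times_amplitude:
  assumes "even M"
  shows "(\<lambda>(s, a). s * a) ` (signs \<times> amplitudes M) = ask_alphabet M" (is "?L = ?R")
proof
  show "?L \<subseteq> ?R"
  proof
    fix x assume "x \<in> ?L"
    then obtain s k where s: "s = -1 \<or> s = 1" and k: "2 * k + 1 < M" and x: "x = s * (2 * int k + 1)"
      by (auto simp: signs_def amplitudes_def)
    obtain h where h: "M = 2 * h" using assms by auto
    from s show "x \<in> ?R"
    proof
      assume "s = -1"
      then have "x = - int M + 1 + 2 * int (h - k - 1)" "h - k - 1 < M" using x h k by auto
      then show ?thesis unfolding ask_alphabet_def by blast
    next
      assume "s = 1"
      then have "x = - int M + 1 + 2 * int (h + k)" "h + k < M" using x h k by auto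
      then show ?thesis unfolding ask_alphabet_def by blast
    qed
  qed
  show "?R \<subseteq> ?L"
  proof
    fix x assume "x \<in> ?R"
    then obtain k where k: "k < M" and x: "x = - int M + 1 + 2 * int k"
      by (auto simp: ask_alphabet_def)
    obtain h where h: "M = 2 * h" using assms by auto
    show "x \<in> ?L"
    proof (cases "h \<le> k")
      case True
      then have "x = 1 * (2 * int (k - h) + 1)" "2 * (k - h) + 1 < M" using x h k by auto
      then show ?thesis by (force simp: signs_def amplitudes_def)
    next
      case False
      then have "x = (-1) * (2 * int (h - k - 1) + 1)" "2 * (h - k - 1) + 1 < M" using x h k by auto
      then show ?thesis by (force simp: signs_def amplitudes_def)
    qed
  qed
qed

definition labels :: "nat \<Rightarrow> bool list set" where
  "labels m = {b. length b = m}"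

text \<open>
  The variables \<open>B\<^sub>1, \<dots>, B\<^sub>m, S, Y\<close>, with bit indices running from \<open>0\<close> to \<open>m - 1\<close>, and a common
  value type for them.
\<close>

datatype var = BVar nat | SVar | YVar

datatype 'y sym = BSym bool | SSym int | YSym 'y

instance sym :: (countable) countable
  by countable_datatype

fun rv :: "var \<Rightarrow> bool list \<times> int \<times> 'y \<Rightarrow> 'y sym" where
  "rv (BVar j) (b, s, y) = BSym (b ! j)"
| "rv SVar (b, s, y) = SSym s"
| "rv YVar (b, s, y) = YSym y"

fun var_seqs :: "bool list list \<Rightarrow> int list \<Rightarrow> 'y list \<Rightarrow> var \<Rightarrow> 'y sym list" where
  "var_seqs bs s y (BVar j) = map BSym (bs ! j)"
| "var_seqs bs s y SVar = map SSym s"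
| "var_seqs bs s y YVar = map YSym y"

definition bit_vars :: "nat \<Rightarrow> var set" where
  "bit_vars m = BVar ` {..<m}"

definition all_vars :: "nat \<Rightarrow> var set" where
  "all_vars m = bit_vars m \<union> {SVar, YVar}"

text \<open>
  The channel \<open>W\<close> is a family of output laws; only its values on the input alphabet are ever used.
\<close>

definition source_channel_law ::
    "(bool list \<Rightarrow> int) \<Rightarrow> (int \<Rightarrow> 'y pmf) \<Rightarrow> bool list pmf \<Rightarrow> (bool list \<times> int \<times> 'y) pmf" where
  "source_channel_law f W p =
     do {
       b \<leftarrow> p;
       s \<leftarrow> pmf_of_set signs;
       y \<leftarrow> W (s * f b);
       return_pmf (b, s, y)
     }"

definition bits_entropy ::
    "nat \<Rightarrow> (bool list \<Rightarrow> int) \<Rightarrow> (int \<Rightarrow> 'y::countable pmf) \<Rightarrow> bool list pmf \<Rightarrow> real" where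
  "bits_entropy m f W p = joint_entropy (source_channel_law f W p) rv (bit_vars m)"

definition R_BMD ::
    "nat \<Rightarrow> (bool list \<Rightarrow> int) \<Rightarrow> (int \<Rightarrow> 'y::countable pmf) \<Rightarrow> bool list pmf \<Rightarrow> real" where
  "R_BMD m f W p =
     (let P = source_channel_law f W p in
        joint_entropy P rv (insert SVar (bit_vars m))
        - cond_entropy P (rv SVar) (rv YVar)
        - (\<Sum>j<m. cond_entropy P (rv (BVar j)) (rv YVar)))"

definition feasible ::
    "nat \<Rightarrow> (bool list \<Rightarrow> int) \<Rightarrow> (int \<Rightarrow> 'y::countable pmf) \<Rightarrow> (bool list pmf \<times> real) set" where
  "feasible m f W =
     {(p, \<gamma>). set_pmf p \<subseteq> labels m \<and> 0 < \<gamma> \<and> \<gamma> < 1 \<and>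
              bits_entropy m f W p + \<gamma> \<le> R_BMD m f W p}"

definition R_BMD_gamma_pos ::
    "nat \<Rightarrow> (bool list \<Rightarrow> int) \<Rightarrow> (int \<Rightarrow> 'y::countable pmf) \<Rightarrow> real" where
  "R_BMD_gamma_pos m f W = (SUP (p, \<gamma>)\<in>feasible m f W. bits_entropy m f W p + \<gamma>)"

text \<open>
  Messages are numbered from \<open>1\<close>. The shaping layer sends \<open>m\<^sub>a\<close> to an \<open>m\<close>-tuple of binary sequences,
  represented as a list of length \<open>m\<close> of lists of length \<open>n\<close>. Since the shaping map and the map to
  first sign parts are injective on the message sets, a function of the amplitude sequence and the
  first sign part is the same thing as a function of the two messages.
\<close>

record sign_coding =
  bit_law :: "bool list pmf"
  sign_frac :: real
  tol :: real
  num_amp :: nat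
  shaping :: "nat \<Rightarrow> bool list list"
  sign1 :: "nat \<Rightarrow> int list"
  sign2 :: "nat \<Rightarrow> nat \<Rightarrow> int list"

definition num_info_signs :: "sign_coding \<Rightarrow> nat \<Rightarrow> nat" where
  "num_info_signs E n = nat \<lfloor>sign_frac E * real n\<rfloor>"

definition num_sign :: "sign_coding \<Rightarrow> nat \<Rightarrow> nat" where
  "num_sign E n = 2 ^ num_info_signs E n"

definition sign_seqs :: "nat \<Rightarrow> int list set" where
  "sign_seqs l = {s. length s = l \<and> set s \<subseteq> signs}"

definition modified_sign_coding ::
    "nat \<Rightarrow> (bool list \<Rightarrow> int) \<Rightarrow> (int \<Rightarrow> 'y::countable pmf) \<Rightarrow> nat \<Rightarrow> sign_coding \<Rightarrow> bool" where
  "modified_sign_coding m f W n E \<longleftrightarrow>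
     set_pmf (bit_law E) \<subseteq> labels m \<and>
     0 < sign_frac E \<and> sign_frac E < 1 \<and> 0 < tol E \<and>
     0 < num_info_signs E n \<and> 1 \<le> num_amp E \<and>
     inj_on (shaping E) {1..num_amp E} \<and>
     (\<forall>ma\<in>{1..num_amp E}.
        length (shaping E ma) = m \<and>
        var_seqs (shaping E ma) [] []
          \<in> B_typical_set (source_channel_law f W (bit_law E)) rv (bit_vars m) {SVar, YVar} n (tol E)) \<and>
     bij_betw (sign1 E) {1..num_sign E n} (sign_seqs (num_info_signs E n)) \<and>
     (\<forall>ma\<in>{1..num_amp E}. \<forall>ms\<in>{1..num_sign E n}.
        sign2 E ma ms \<in> sign_seqs (n - num_info_signs E n))"

definition amp_seq :: "nat \<Rightarrow> (bool list \<Rightarrow> int) \<Rightarrow> nat \<Rightarrow> sign_coding \<Rightarrow> nat \<Rightarrow> int list" where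
  "amp_seq m f n E ma = map (\<lambda>i. f (map (\<lambda>j. shaping E ma ! j ! i) [0..<m])) [0..<n]"

definition sign_seq :: "sign_coding \<Rightarrow> nat \<Rightarrow> nat \<Rightarrow> int list" where
  "sign_seq E ma ms = sign1 E ms @ sign2 E ma ms"

definition codeword :: "nat \<Rightarrow> (bool list \<Rightarrow> int) \<Rightarrow> nat \<Rightarrow> sign_coding \<Rightarrow> nat \<Rightarrow> nat \<Rightarrow> int list" where
  "codeword m f n E ma ms = map2 (*) (amp_seq m f n E ma) (sign_seq E ma ms)"

definition memoryless :: "(int \<Rightarrow> 'y pmf) \<Rightarrow> int list \<Rightarrow> 'y list pmf" where
  "memoryless W x =
     map_pmf (\<lambda>y. map y [0..<length x]) (Pi_pmf {..<length x} undefined (\<lambda>i. W (x ! i)))"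

definition bmd_match ::
    "nat \<Rightarrow> (bool list \<Rightarrow> int) \<Rightarrow> (int \<Rightarrow> 'y::countable pmf) \<Rightarrow> nat \<Rightarrow> sign_coding \<Rightarrow>
     'y list \<Rightarrow> nat \<Rightarrow> nat \<Rightarrow> bool" where
  "bmd_match m f W n E y ma ms \<longleftrightarrow>
     (let P = source_channel_law f W (bit_law E);
          x = var_seqs (shaping E ma) (sign_seq E ma ms) y in
        x \<in> typical_set P rv {SVar, YVar} n (tol E) \<and>
        (\<forall>j<m. x \<in> typical_set P rv {BVar j, YVar} n (tol E)))"

text \<open>The value \<^const>\<open>None\<close> stands for a declared error.\<close>

definition bmd_decode ::
    "nat \<Rightarrow> (bool list \<Rightarrow> int) \<Rightarrow> (int \<Rightarrow> 'y::countable pmf) \<Rightarrow> nat \<Rightarrow> sign_coding \<Rightarrow>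
     'y list \<Rightarrow> (nat \<times> nat) option" where
  "bmd_decode m f W n E y =
     (let C = {(ma, ms). ma \<in> {1..num_amp E} \<and> ms \<in> {1..num_sign E n} \<and>
                         bmd_match m f W n E y ma ms} in
        if \<exists>!c. c \<in> C then Some (THE c. c \<in> C) else None)"

definition transmission ::
    "nat \<Rightarrow> (bool list \<Rightarrow> int) \<Rightarrow> (int \<Rightarrow> 'y pmf) \<Rightarrow> nat \<Rightarrow> sign_coding \<Rightarrow>
     ((nat \<times> nat) \<times> 'y list) pmf" where
  "transmission m f W n E =
     do {
       ma \<leftarrow> pmf_of_set {1..num_amp E};
       ms \<leftarrow> pmf_of_set {1..num_sign E n};
       y \<leftarrow> memoryless W (codeword m f n E ma ms);
       return_pmf ((ma, ms), y)
     }"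

definition error_prob ::
    "nat \<Rightarrow> (bool list \<Rightarrow> int) \<Rightarrow> (int \<Rightarrow> 'y::countable pmf) \<Rightarrow> nat \<Rightarrow> sign_coding \<Rightarrow> real" where
  "error_prob m f W n E =
     measure_pmf.prob (transmission m f W n E) {(c, y). bmd_decode m f W n E y \<noteq> Some c}"

definition achievable ::
    "nat \<Rightarrow> (bool list \<Rightarrow> int) \<Rightarrow> (int \<Rightarrow> 'y::countable pmf) \<Rightarrow> real \<Rightarrow> bool" where
  "achievable m f W R \<longleftrightarrow>
     (\<forall>\<delta>>0. \<forall>\<^sub>F n in sequentially. \<exists>E.
        modified_sign_coding m f W n E \<and>
        (1 / real n) * log 2 (real (num_amp E * num_sign E n)) \<ge> R - \<delta> \<and>
        error_prob m f W n E \<le> \<delta>)"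

end

theory Submission
  imports Defs
begin

text \<open>
  Given a feasible \<open>(p, \<gamma>)\<close>, take all of the \<open>\<B>\<close>-typical set as amplitude codebook and lower \<open>\<gamma>\<close>
  slightly. By the asymptotic equipartition property the codebook has about \<open>2\<^bsup>n H(B)\<^esup>\<close> elements, so the
  rate is about \<open>H(B) + \<gamma>\<close>; only the second sign parts are left to choose.

  The defining property of the \<open>\<B>\<close>-typical set says that, averaged over all sign sequences, the
  transmitted pair fails to match the output with probability at most \<open>\<epsilon>\<close>. For a fixed output, at
  most \<open>2\<^bsup>n (H(S|Y) + \<Sum>\<^sub>j H(B\<^sub>j|Y) + O(\<epsilon>))\<^esup>\<close> pairs of a codeword and a sign sequence match at all. A
  uniformly random second sign part hits each of its values with probability \<open>2\<^bsup>-n(1-\<gamma>)\<^esup>\<close>, and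
  feasibility, after cancelling \<open>H(B)\<close>, is \<open>H(S|Y) + \<Sum>\<^sub>j H(B\<^sub>j|Y) \<le> 1 - \<gamma>\<close>. Hence the expected number
  of wrong matches vanishes, and some choice is at least as good as the average.
\<close>

section \<open>The weak law of large numbers\<close>

text \<open>The first sign part is fixed by the message and is not drawn at random, whereas the
  B-typical set speaks of a uniformly random sign sequence. The two agree on average: for each
  amplitude codeword the first part runs through every sign string of its length exactly once, and
  the second part is drawn uniformly. Two distinct message pairs receive independent second parts
  even if they share the amplitude sequence or the first sign part; hence one estimate covers all
  wrong pairs, without distinguishing which message is wrong. The averaged quantity is a sum of
  terms that depend on at most two values of the random choice. The count of matching pairs is
  uniform in the output, because the sign sequence and every bit level are tested against the output
  separately. Lowering \<gamma> by some \<tau> makes room for the typicality slack: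
  \<open>2 * (m + 1) * \<epsilon>\<close> per symbol is kept below \<open>\<tau> / 2\<close>, and
  the other half of \<tau> gives exponential decay. The no-match term stays of size \<epsilon>, so
  \<epsilon> must itself lie below the error target.\<close>

lemma truncation_tail:
  fixes g :: "'a \<Rightarrow> real"
  assumes g: "integrable M g" and "\<eta> > 0"
  shows "\<exists>K>0. (\<integral>x. \<bar>if \<bar>g x\<bar> \<le> K then 0 else g x\<bar> \<partial>M) < \<eta>"
proof -
  have [measurable]: "g \<in> borel_measurable M" using g by auto
  have "(\<lambda>k. \<integral>x. \<bar>if \<bar>g x\<bar> \<le> real k then 0 else g x\<bar> \<partial>M) \<longlonglongrightarrow> (\<integral>x. 0 \<partial>M)"
  proof (rule integral_dominated_convergence[where w = "\<lambda>x. \<bar>g x\<bar>"])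
    show "AE x in M. (\<lambda>k. \<bar>if \<bar>g x\<bar> \<le> real k then 0 else g x\<bar>) \<longlonglongrightarrow> 0"
    proof (rule AE_I2)
      fix x
      have "\<forall>\<^sub>F k in sequentially. \<bar>if \<bar>g x\<bar> \<le> real k then 0 else g x\<bar> = 0"
        using eventually_ge_at_top[of "nat \<lceil>\<bar>g x\<bar>\<rceil>"] by eventually_elim (simp; linarith)
      then show "(\<lambda>k. \<bar>if \<bar>g x\<bar> \<le> real k then 0 else g x\<bar>) \<longlonglongrightarrow> 0"
        by (rule tendsto_eventually)
    qed
  qed (use g in auto)
  then have "\<forall>\<^sub>F k in sequentially. (\<integral>x. \<bar>if \<bar>g x\<bar> \<le> real k then 0 else g x\<bar> \<partial>M) < \<eta>"
    using assms(2) by (simp add: order_tendsto_iff)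
  then have "\<forall>\<^sub>F k in sequentially. k > 0 \<and> (\<integral>x. \<bar>if \<bar>g x\<bar> \<le> real k then 0 else g x\<bar> \<partial>M) < \<eta>"
    using eventually_gt_at_top[of 0] by eventually_elim auto
  then obtain k where "k > 0" "(\<integral>x. \<bar>if \<bar>g x\<bar> \<le> real k then 0 else g x\<bar> \<partial>M) < \<eta>"
    by (auto dest: eventually_happens)
  then show ?thesis
    by (intro exI[of _ "real k"]) simp
qed

lemma Pi_pmf_component_integral:
  fixes g :: "'a \<Rightarrow> real"
  assumes "finite I" "i \<in> I"
  shows "measure_pmf.expectation (Pi_pmf I d p) (\<lambda>\<omega>. g (\<omega> i)) = measure_pmf.expectation (p i) g"
    and "integrable (measure_pmf (p i)) g \<Longrightarrow> integrable (measure_pmf (Pi_pmf I d p)) (\<lambda>\<omega>. g (\<omega> i))"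
proof -
  have eq: "map_pmf (\<lambda>\<omega>. \<omega> i) (Pi_pmf I d p) = p i"
    using assms by (simp add: Pi_pmf_component)
  show "measure_pmf.expectation (Pi_pmf I d p) (\<lambda>\<omega>. g (\<omega> i)) = measure_pmf.expectation (p i) g"
    unfolding eq[symmetric] by simp
  show "integrable (measure_pmf (p i)) g \<Longrightarrow> integrable (measure_pmf (Pi_pmf I d p)) (\<lambda>\<omega>. g (\<omega> i))"
    unfolding eq[symmetric] by simp
qed

text \<open>Hoeffding's inequality for variables in \<open>[-K, K]\<close>; the factor
  \<open>2 * K\<close> is the length of that interval. For \<open>n > 0\<close> coordinate
  \<open>0\<close> can serve as the reference variable with the common law.\<close>

lemma bounded_iid_deviation:
  fixes g :: "'a \<Rightarrow> real"
  assumes K: "K > 0" "\<And>x. \<bar>g x\<bar> \<le> K" and "\<epsilon> \<ge> 0" and "n > 0"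
  shows "measure_pmf.prob (Pi_pmf {..<n} d (\<lambda>_. P))
           {\<omega>. \<epsilon> \<le> \<bar>(\<Sum>i<n. g (\<omega> i)) / real n - measure_pmf.expectation P g\<bar>}
         \<le> 2 * exp (- 2 * real n * \<epsilon>\<^sup>2 / (2 * K)\<^sup>2)"
proof -
  let ?Q = "Pi_pmf {..<n} d (\<lambda>_. P)"
  have distr: "distr (measure_pmf ?Q) borel (\<lambda>\<omega>. g (\<omega> i)) = distr (measure_pmf P) borel g"
    if "i < n" for i
  proof -
    have "P = map_pmf (\<lambda>\<omega>. \<omega> i) ?Q"
      using that by (simp add: Pi_pmf_component)
    then have "distr (measure_pmf P) borel g
        = distr (distr (measure_pmf ?Q) (count_space UNIV) (\<lambda>\<omega>. \<omega> i)) borel g"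
      by (metis map_pmf_rep_eq)
    also have "\<dots> = distr (measure_pmf ?Q) borel (\<lambda>\<omega>. g (\<omega> i))"
      by (subst distr_distr) (auto simp: comp_def)
    finally show ?thesis by simp
  qed
  interpret Hoeffding_ineq_iid "measure_pmf ?Q" "{..<n}" "\<lambda>i \<omega>. g (\<omega> i)" "\<lambda>\<omega>. g (\<omega> 0)" "-K" K
    "measure_pmf.expectation ?Q (\<lambda>\<omega>. g (\<omega> 0))"
  proof unfold_locales
    show "prob_space.indep_vars (measure_pmf ?Q) (\<lambda>_. borel) (\<lambda>i \<omega>. g (\<omega> i)) {..<n}"
      by (rule prob_space.indep_vars_compose2[OF _ indep_vars_Pi_pmf])
        (auto simp: measure_pmf.prob_space_axioms)
    show "AE \<omega> in measure_pmf ?Q. g (\<omega> 0) \<in> {- K..K}"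
      using K(2) by (auto simp: abs_le_iff minus_le_iff)
  qed (use distr \<open>n > 0\<close> in auto)
  have "measure_pmf.expectation ?Q (\<lambda>\<omega>. g (\<omega> 0)) = measure_pmf.expectation P g"
    using \<open>n > 0\<close> by (subst Pi_pmf_component_integral(1)) auto
  moreover have "{..<n} \<noteq> {}" using \<open>n > 0\<close> by auto
  ultimately show ?thesis
    using Hoeffding_ineq_abs_ge'[OF \<open>\<epsilon> \<ge> 0\<close>] K(1) by simp
qed

text \<open>
  No second moment is available for an information density on a countable alphabet, so
  \<open>g\<close> is split at a fixed level \<open>K\<close>: the bounded part concentrates by Hoeffding's inequality, and
  the tail has small mean and is controlled by Markov's inequality.
\<close>

lemma weak_law_Pi_pmf:
  fixes g :: "'a \<Rightarrow> real"
  assumes g: "integrable (measure_pmf P) g" and \<epsilon>: "\<epsilon> > 0"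
  shows "(\<lambda>n. measure_pmf.prob (Pi_pmf {..<n} d (\<lambda>_. P))
           {\<omega>. \<epsilon> < \<bar>(\<Sum>i<n. g (\<omega> i)) / real n - measure_pmf.expectation P g\<bar>}) \<longlonglongrightarrow> 0"
    (is "?p \<longlonglongrightarrow> 0")
proof (rule order_tendstoI)
  fix \<eta> :: real assume \<eta>: "\<eta> > 0"
  \<comment> \<open>The bound \<open>\<epsilon> / 3\<close> keeps the mean of the tail below one
    third of the allowed deviation, so that one of the other two thirds must be exceeded by the
    bounded part or by the empirical tail. The bound \<open>\<epsilon> * \<eta> / 6\<close> makes
    Markov's inequality at level \<open>\<epsilon> / 3\<close> yield
    \<open>\<eta> / 2\<close>.\<close>
  obtain K where K: "K > 0" and tail: "(\<integral>x. \<bar>if \<bar>g x\<bar> \<le> K then 0 else g x\<bar> \<partial>measure_pmf P)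
      < min (\<epsilon> / 3) (\<epsilon> * \<eta> / 6)"
    using truncation_tail[OF g, of "min (\<epsilon> / 3) (\<epsilon> * \<eta> / 6)"] \<epsilon> \<eta> by auto
  define h where "h x = (if \<bar>g x\<bar> \<le> K then 0 else g x)" for x
  define b where "b x = (if \<bar>g x\<bar> \<le> K then g x else 0)" for x
  have g_eq: "g x = b x + h x" for x by (simp add: b_def h_def)
  have int_h: "integrable (measure_pmf P) h"
    by (rule Bochner_Integration.integrable_bound[OF g]) (auto simp: h_def)
  have int_b: "integrable (measure_pmf P) b"
    by (rule Bochner_Integration.integrable_bound[OF g]) (auto simp: b_def)
  define t where "t = measure_pmf.expectation P (\<lambda>x. \<bar>h x\<bar>)"
  have t: "t < \<epsilon> / 3" "t < \<epsilon> * \<eta> / 6" using tail by (auto simp: t_def h_def)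
  have Eh: "\<bar>measure_pmf.expectation P h\<bar> \<le> t"
    unfolding t_def by (rule integral_abs_bound)
  have Eg: "measure_pmf.expectation P g = measure_pmf.expectation P b + measure_pmf.expectation P h"
    unfolding g_eq by (rule Bochner_Integration.integral_add[OF int_b int_h])
  have bound: "?p n \<le> 2 * exp (- 2 * real n * (\<epsilon> / 3)\<^sup>2 / (2 * K)\<^sup>2) + \<eta> / 2" if n: "n > 0" for n
  proof -
    let ?Q = "Pi_pmf {..<n} d (\<lambda>_. P)"
    let ?A = "{\<omega>. \<epsilon> / 3 \<le> \<bar>(\<Sum>i<n. b (\<omega> i)) / real n - measure_pmf.expectation P b\<bar>}"
    let ?B = "{\<omega>. \<epsilon> / 3 \<le> (\<Sum>i<n. \<bar>h (\<omega> i)\<bar>) / real n}"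
    have "?p n \<le> measure_pmf.prob ?Q (?A \<union> ?B)"
    proof (rule measure_pmf.finite_measure_mono)
      show "{\<omega>. \<epsilon> < \<bar>(\<Sum>i<n. g (\<omega> i)) / real n - measure_pmf.expectation P g\<bar>} \<subseteq> ?A \<union> ?B"
      proof safe
        fix \<omega>
        assume *: "\<epsilon> < \<bar>(\<Sum>i<n. g (\<omega> i)) / real n - measure_pmf.expectation P g\<bar>"
          and **: "\<not> \<epsilon> / 3 \<le> (\<Sum>i<n. \<bar>h (\<omega> i)\<bar>) / real n"
        have "\<bar>(\<Sum>i<n. h (\<omega> i)) / real n\<bar> \<le> (\<Sum>i<n. \<bar>h (\<omega> i)\<bar>) / real n"
          by (simp add: abs_divide divide_right_mono sum_abs)
        moreover have "(\<Sum>i<n. g (\<omega> i)) / real n = (\<Sum>i<n. b (\<omega> i)) / real n + (\<Sum>i<n. h (\<omega> i)) / real n"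
          by (simp add: g_eq sum.distrib add_divide_distrib)
        ultimately show "\<epsilon> / 3 \<le> \<bar>(\<Sum>i<n. b (\<omega> i)) / real n - measure_pmf.expectation P b\<bar>"
          using * ** Eh Eg t(1) by linarith
      qed
    qed simp
    also have "\<dots> \<le> measure_pmf.prob ?Q ?A + measure_pmf.prob ?Q ?B"
      by (rule measure_Un_le) auto
    also have "measure_pmf.prob ?Q ?A \<le> 2 * exp (- 2 * real n * (\<epsilon> / 3)\<^sup>2 / (2 * K)\<^sup>2)"
      by (rule bounded_iid_deviation) (use K \<epsilon> n in \<open>auto simp: b_def\<close>)
    also have "measure_pmf.prob ?Q ?B \<le> \<eta> / 2"
    proof -
      have int: "integrable (measure_pmf ?Q) (\<lambda>\<omega>. \<bar>h (\<omega> i)\<bar>)" if "i < n" for i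
        using that int_h by (intro Pi_pmf_component_integral(2)) auto
      have "measure_pmf.expectation ?Q (\<lambda>\<omega>. (\<Sum>i<n. \<bar>h (\<omega> i)\<bar>) / real n)
          = (\<Sum>i<n. measure_pmf.expectation ?Q (\<lambda>\<omega>. \<bar>h (\<omega> i)\<bar>)) / real n"
        using int by (simp add: Bochner_Integration.integral_sum)
      also have "\<dots> = t"
        using n by (simp add: Pi_pmf_component_integral(1)[where g = "\<lambda>x. \<bar>h x\<bar>"] t_def)
      finally have E: "measure_pmf.expectation ?Q (\<lambda>\<omega>. (\<Sum>i<n. \<bar>h (\<omega> i)\<bar>) / real n) = t" .
      have "measure_pmf.prob ?Q {\<omega> \<in> space (measure_pmf ?Q). \<epsilon> / 3 \<le> (\<Sum>i<n. \<bar>h (\<omega> i)\<bar>) / real n}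
          \<le> measure_pmf.expectation ?Q (\<lambda>\<omega>. (\<Sum>i<n. \<bar>h (\<omega> i)\<bar>) / real n) / (\<epsilon> / 3)"
      proof (rule integral_Markov_inequality_measure[where A = "{}"])
        show "integrable (measure_pmf ?Q) (\<lambda>\<omega>. (\<Sum>i<n. \<bar>h (\<omega> i)\<bar>) / real n)"
          using int by (intro integrable_divide_zero Bochner_Integration.integrable_sum) auto
        show "AE \<omega> in measure_pmf ?Q. 0 \<le> (\<Sum>i<n. \<bar>h (\<omega> i)\<bar>) / real n"
          by (intro AE_I2 divide_nonneg_nonneg sum_nonneg) auto
      qed (use \<epsilon> in auto)
      also have "\<dots> \<le> \<eta> / 2"
        unfolding E using t(2) \<epsilon> by (simp add: field_simps)
      finally show ?thesis by simp
    qed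
    finally show ?thesis by simp
  qed
  define c where "c = 2 * (\<epsilon> / 3)\<^sup>2 / (2 * K)\<^sup>2"
  have c: "c > 0" using \<epsilon> K by (simp add: c_def)
  have "(\<lambda>n. 2 * exp (- c) ^ n) \<longlonglongrightarrow> 2 * 0"
    using c by (intro tendsto_mult tendsto_const LIMSEQ_realpow_zero) auto
  then have "(\<lambda>n. 2 * exp (- (c * real n))) \<longlonglongrightarrow> 0"
    by (simp add: exp_of_nat_mult[symmetric] mult.commute)
  then have "\<forall>\<^sub>F n in sequentially. 2 * exp (- (c * real n)) < \<eta> / 2"
    by (rule order_tendstoD(2)) (use \<eta> in simp)
  then show "\<forall>\<^sub>F n in sequentially. ?p n < \<eta>"
    using eventually_gt_at_top[of 0]
  proof eventually_elim
    case (elim n)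
    have "- 2 * real n * (\<epsilon> / 3)\<^sup>2 / (2 * K)\<^sup>2 = - (c * real n)" by (simp add: c_def)
    with bound[OF elim(2)] elim(1) show ?case by simp
  qed
next
  fix a :: real assume "a < 0"
  then show "\<forall>\<^sub>F n in sequentially. a < ?p n"
    by (intro always_eventually allI) (rule less_le_trans[OF _ measure_nonneg])
qed

section \<open>Derandomisation\<close>

lemma ex_le_average:
  fixes f :: "'a \<Rightarrow> real"
  assumes "finite D" "D \<noteq> {}"
  shows "\<exists>d\<in>D. f d \<le> (\<Sum>x\<in>D. f x) / card D"
proof (rule ccontr)
  assume "\<not> ?thesis"
  then have "(\<Sum>x\<in>D. (\<Sum>x\<in>D. f x) / card D) < (\<Sum>x\<in>D. f x)"
    using assms by (intro sum_strict_mono) auto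
  then show False using assms by simp
qed

text \<open>The method of conditional expectations, fixing one coordinate of \<open>g\<close> at a time.\<close>

lemma ex_choice_le_average:
  fixes u :: "'i \<Rightarrow> 'd \<Rightarrow> real" and v :: "'i \<Rightarrow> 'i \<Rightarrow> 'd \<Rightarrow> 'd \<Rightarrow> real"
  assumes "finite I" and D: "finite D" "D \<noteq> {}"
  shows "\<exists>g\<in>I \<rightarrow> D.
           (\<Sum>i\<in>I. u i (g i)) + (\<Sum>i\<in>I. \<Sum>j\<in>I - {i}. v i j (g i) (g j))
           \<le> (\<Sum>i\<in>I. (\<Sum>d\<in>D. u i d) / card D)
             + (\<Sum>i\<in>I. \<Sum>j\<in>I - {i}. (\<Sum>d\<in>D. \<Sum>e\<in>D. v i j d e) / (real (card D))\<^sup>2)"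
  using assms(1)
proof (induction I arbitrary: u)
  case empty
  then show ?case by simp
next
  case (insert k I)
  \<comment> \<open>\<open>u'\<close> charges to coordinate \<open>i\<close> its pair terms with
    \<open>k\<close>, averaged over the still open value at \<open>k\<close>. The induction
    hypothesis for \<open>u'\<close> thus fixes all other coordinates while \<open>k\<close> remains
    random.\<close>
  define u' where "u' i d = u i d + (\<Sum>e\<in>D. v i k d e + v k i e d) / card D" for i d
  obtain g where g: "g \<in> I \<rightarrow> D"
    and le: "(\<Sum>i\<in>I. u' i (g i)) + (\<Sum>i\<in>I. \<Sum>j\<in>I - {i}. v i j (g i) (g j))
           \<le> (\<Sum>i\<in>I. (\<Sum>d\<in>D. u' i d) / card D)
             + (\<Sum>i\<in>I. \<Sum>j\<in>I - {i}. (\<Sum>d\<in>D. \<Sum>e\<in>D. v i j d e) / (real (card D))\<^sup>2)"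
    using insert.IH[of u'] by blast
  \<comment> \<open>With the other coordinates fixed, \<open>t\<close> collects everything that
    depends on the value at \<open>k\<close>; its average over \<open>D\<close> is what
    \<open>u'\<close> has already paid for, plus the average of \<open>u k\<close>.\<close>
  define t where "t d = u k d + (\<Sum>i\<in>I. v i k (g i) d + v k i d (g i))" for d
  obtain d where d: "d \<in> D" and "t d \<le> (\<Sum>x\<in>D. t x) / card D"
    using ex_le_average[OF D, of t] by blast
  have pairs: "(\<Sum>i\<in>insert k I. \<Sum>j\<in>insert k I - {i}. f i j)
      = (\<Sum>i\<in>I. f i k + f k i) + (\<Sum>i\<in>I. \<Sum>j\<in>I - {i}. f i j)" for f :: "'i \<Rightarrow> 'i \<Rightarrow> real"
  proof -
    have "insert k I - {k} = I" using insert.hyps by auto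
    moreover have "(\<Sum>j\<in>insert k I - {i}. f i j) = f i k + (\<Sum>j\<in>I - {i}. f i j)" if "i \<in> I" for i
    proof -
      have "insert k I - {i} = insert k (I - {i})" using insert.hyps that by auto
      then show ?thesis using insert.hyps by simp
    qed
    ultimately show ?thesis using insert.hyps by (simp add: sum.distrib)
  qed
  have avg_t: "(\<Sum>x\<in>D. t x) / card D
      = (\<Sum>x\<in>D. u k x) / card D + (\<Sum>i\<in>I. (\<Sum>x\<in>D. v i k (g i) x + v k i x (g i)) / card D)"
    unfolding t_def sum.distrib add_divide_distrib sum_divide_distrib
    by (simp add: sum.swap[of _ D I])
  have avg_u': "(\<Sum>i\<in>I. (\<Sum>d\<in>D. u' i d) / card D)
      = (\<Sum>i\<in>I. (\<Sum>d\<in>D. u i d) / card D)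
        + (\<Sum>i\<in>I. (\<Sum>d\<in>D. \<Sum>e\<in>D. v i k d e) / (real (card D))\<^sup>2 + (\<Sum>d\<in>D. \<Sum>e\<in>D. v k i d e) / (real (card D))\<^sup>2)"
  proof -
    have "(\<Sum>d\<in>D. u' i d) / card D = (\<Sum>d\<in>D. u i d) / card D
        + ((\<Sum>d\<in>D. \<Sum>e\<in>D. v i k d e) / (real (card D))\<^sup>2 + (\<Sum>d\<in>D. \<Sum>e\<in>D. v k i d e) / (real (card D))\<^sup>2)" for i
    proof -
      have "(\<Sum>d\<in>D. (\<Sum>e\<in>D. v k i e d)) = (\<Sum>d\<in>D. \<Sum>e\<in>D. v k i d e)"
        by (rule sum.swap)
      then show ?thesis
        unfolding u'_def sum.distrib add_divide_distrib
        by (simp add: power2_eq_square flip: sum_divide_distrib)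
    qed
    then show ?thesis by (simp add: sum.distrib)
  qed
  define g' where "g' = g(k := d)"
  have g': "g' k = d" "\<And>i. i \<in> I \<Longrightarrow> g' i = g i"
    using insert.hyps by (auto simp: g'_def)
  have "(\<Sum>i\<in>insert k I. u i (g' i)) + (\<Sum>i\<in>insert k I. \<Sum>j\<in>insert k I - {i}. v i j (g' i) (g' j))
      = t d + (\<Sum>i\<in>I. u i (g i)) + (\<Sum>i\<in>I. \<Sum>j\<in>I - {i}. v i j (g i) (g j))"
    unfolding pairs using insert.hyps by (simp add: t_def g' cong: sum.cong_simp)
  also have "\<dots> \<le> (\<Sum>x\<in>D. u k x) / card D
      + ((\<Sum>i\<in>I. u' i (g i)) + (\<Sum>i\<in>I. \<Sum>j\<in>I - {i}. v i j (g i) (g j)))"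
    using \<open>t d \<le> _\<close> by (simp add: avg_t u'_def sum.distrib)
  also have "\<dots> \<le> (\<Sum>x\<in>D. u k x) / card D + ((\<Sum>i\<in>I. (\<Sum>d\<in>D. u' i d) / card D)
             + (\<Sum>i\<in>I. \<Sum>j\<in>I - {i}. (\<Sum>d\<in>D. \<Sum>e\<in>D. v i j d e) / (real (card D))\<^sup>2))"
    using le by simp
  also have "\<dots> = (\<Sum>i\<in>insert k I. (\<Sum>d\<in>D. u i d) / card D)
      + (\<Sum>i\<in>insert k I. \<Sum>j\<in>insert k I - {i}. (\<Sum>d\<in>D. \<Sum>e\<in>D. v i j d e) / (real (card D))\<^sup>2)"
    unfolding pairs avg_u' using insert.hyps by simp
  finally show ?case
    using g d by (intro bexI[of _ g']) (auto simp: g'_def)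
qed

text \<open>An average over all functions \<open>g\<close> from pairs (codeword, first sign part) to
  second sign parts. Averaging over the sender's value of \<open>g\<close> completes the sum over
  \<open>S1\<close> to one over \<open>S1 \<times> S2\<close>, which is the form of the bound on
  \<open>q\<close>. In the pair terms the competitor's value is averaged as well; its normalisation
  leaves the factor \<open>1 / card S2\<close> on \<beta>.\<close>

lemma ex_good_code:
  fixes q :: "'b \<Rightarrow> 's \<times> 't \<Rightarrow> real" and v :: "'b \<Rightarrow> 's \<times> 't \<Rightarrow> 'b \<Rightarrow> 's \<times> 't \<Rightarrow> real"
  assumes T: "finite T" and S1: "finite S1" and S2: "finite S2" "S2 \<noteq> {}"
    and nn: "\<And>b \<sigma> b' \<sigma>'. 0 \<le> v b \<sigma> b' \<sigma>'"
    and q: "\<And>b. b \<in> T \<Longrightarrow> (\<Sum>\<sigma>\<in>S1 \<times> S2. q b \<sigma>) \<le> \<epsilon> * (real (card S1) * real (card S2))"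
    and v: "\<And>b \<sigma>. b \<in> T \<Longrightarrow> \<sigma> \<in> S1 \<times> S2 \<Longrightarrow> (\<Sum>b'\<in>T. \<Sum>\<sigma>'\<in>S1 \<times> S2. v b \<sigma> b' \<sigma>') \<le> \<beta>"
  shows "\<exists>g\<in>T \<times> S1 \<rightarrow> S2.
           (\<Sum>(b, s)\<in>T \<times> S1. q b (s, g (b, s)))
           + (\<Sum>(b, s)\<in>T \<times> S1. \<Sum>(b', s')\<in>T \<times> S1 - {(b, s)}. v b (s, g (b, s)) b' (s', g (b', s')))
           \<le> (real (card T) * real (card S1)) * (\<epsilon> + \<beta> / real (card S2))"
proof -
  let ?N = "real (card T)" and ?s1 = "real (card S1)" and ?s2 = "real (card S2)"
  have pos: "?s2 > 0" using S2 by (auto simp: card_gt_0_iff)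
  define V where "V b b' = (\<Sum>\<sigma>\<in>S1 \<times> S2. \<Sum>\<sigma>'\<in>S1 \<times> S2. v b \<sigma> b' \<sigma>')" for b b'
  define u where "u i d = q (fst i) (snd i, d)" for i d
  define v' where "v' i j d e = v (fst i) (snd i, d) (fst j) (snd j, e)" for i j d e
  obtain g where g: "g \<in> T \<times> S1 \<rightarrow> S2"
    and le: "(\<Sum>i\<in>T \<times> S1. u i (g i)) + (\<Sum>i\<in>T \<times> S1. \<Sum>j\<in>T \<times> S1 - {i}. v' i j (g i) (g j))
           \<le> (\<Sum>i\<in>T \<times> S1. (\<Sum>d\<in>S2. u i d) / ?s2)
             + (\<Sum>i\<in>T \<times> S1. \<Sum>j\<in>T \<times> S1 - {i}. (\<Sum>d\<in>S2. \<Sum>e\<in>S2. v' i j d e) / ?s2\<^sup>2)"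
    using ex_choice_le_average[of "T \<times> S1" S2 u v'] T S1 S2 by auto
  have "(\<Sum>i\<in>T \<times> S1. (\<Sum>d\<in>S2. u i d) / ?s2) = (\<Sum>b\<in>T. \<Sum>\<sigma>\<in>S1 \<times> S2. q b \<sigma>) / ?s2"
    by (simp add: u_def sum.cartesian_product' sum_divide_distrib)
  also have "\<dots> \<le> (\<Sum>b\<in>T. \<epsilon> * (?s1 * ?s2)) / ?s2"
    using pos q by (intro divide_right_mono sum_mono) auto
  also have "\<dots> = (?N * ?s1) * \<epsilon>" using pos by simp
  finally have 1: "(\<Sum>i\<in>T \<times> S1. (\<Sum>d\<in>S2. u i d) / ?s2) \<le> (?N * ?s1) * \<epsilon>" .
  have v'_nn: "(\<Sum>d\<in>S2. \<Sum>e\<in>S2. v' i j d e) \<ge> 0" for i j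
    unfolding v'_def by (intro sum_nonneg nn)
  \<comment> \<open>Nonnegativity of \<open>v\<close> allows the diagonal to be added back, after
    which the inner sum runs over all competitors and the hypothesis on \<open>v\<close>
    applies.\<close>
  have "(\<Sum>i\<in>T \<times> S1. \<Sum>j\<in>T \<times> S1 - {i}. (\<Sum>d\<in>S2. \<Sum>e\<in>S2. v' i j d e) / ?s2\<^sup>2)
      \<le> (\<Sum>i\<in>T \<times> S1. \<Sum>j\<in>T \<times> S1. (\<Sum>d\<in>S2. \<Sum>e\<in>S2. v' i j d e) / ?s2\<^sup>2)"
    using v'_nn T S1 by (intro sum_mono sum_mono2) auto
  also have "\<dots> = (\<Sum>b\<in>T. \<Sum>b'\<in>T. V b b') / ?s2\<^sup>2"
  proof -
    have "(\<Sum>s\<in>S1. \<Sum>b'\<in>T. \<Sum>s'\<in>S1. \<Sum>d\<in>S2. \<Sum>e\<in>S2. v b (s, d) b' (s', e))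
        = (\<Sum>b'\<in>T. \<Sum>s\<in>S1. \<Sum>d\<in>S2. \<Sum>s'\<in>S1. \<Sum>e\<in>S2. v b (s, d) b' (s', e))" for b
      by (subst sum.swap) (intro sum.cong refl sum.swap)
    then show ?thesis
      by (simp add: v'_def V_def sum.cartesian_product' flip: sum_divide_distrib)
  qed
  also have "\<dots> \<le> (\<Sum>b\<in>T. ?s1 * ?s2 * \<beta>) / ?s2\<^sup>2"
  proof (intro divide_right_mono sum_mono)
    fix b assume b: "b \<in> T"
    have "(\<Sum>y\<in>T. V b y) = (\<Sum>\<sigma>\<in>S1 \<times> S2. \<Sum>y\<in>T. \<Sum>\<sigma>'\<in>S1 \<times> S2. v b \<sigma> y \<sigma>')"
      unfolding V_def by (rule sum.swap)
    also have "\<dots> \<le> (\<Sum>\<sigma>\<in>S1 \<times> S2. \<beta>)" using v b by (intro sum_mono) auto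
    finally show "(\<Sum>y\<in>T. V b y) \<le> ?s1 * ?s2 * \<beta>" by (simp add: card_cartesian_product)
  qed simp
  also have "\<dots> = (?N * ?s1) * (\<beta> / ?s2)"
    using pos by (simp add: field_simps power2_eq_square)
  finally have 2: "(\<Sum>i\<in>T \<times> S1. \<Sum>j\<in>T \<times> S1 - {i}. (\<Sum>d\<in>S2. \<Sum>e\<in>S2. v' i j d e) / ?s2\<^sup>2)
      \<le> (?N * ?s1) * (\<beta> / ?s2)" .
  have "(\<Sum>i\<in>T \<times> S1. u i (g i)) + (\<Sum>i\<in>T \<times> S1. \<Sum>j\<in>T \<times> S1 - {i}. v' i j (g i) (g j))
      \<le> (?N * ?s1) * (\<epsilon> + \<beta> / ?s2)"
    using le 1 2 by (simp add: distrib_left)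
  then show ?thesis
    using g by (intro bexI[of _ g]) (auto simp: u_def v'_def case_prod_unfold)
qed

section \<open>Information density and typical sequences\<close>

definition info :: "'o pmf \<Rightarrow> ('k \<Rightarrow> 'o \<Rightarrow> 'v) \<Rightarrow> 'k set \<Rightarrow> 'o \<Rightarrow> real" where
  "info P X J \<omega> = - log 2 (pmf (joint_law P X J) (joint_rv X J \<omega>))"

lemma pmf_joint_law:
  "pmf (joint_law P X J) (joint_rv X J \<omega>) = measure_pmf.prob P {\<omega>'. \<forall>k\<in>J. X k \<omega>' = X k \<omega>}"
proof -
  have "joint_rv X J -` {joint_rv X J \<omega>} = {\<omega>'. \<forall>k\<in>J. X k \<omega>' = X k \<omega>}"
    by (auto simp: joint_rv_def fun_eq_iff) (metis restrict_apply')
  then show ?thesis by (simp add: joint_law_def pmf_map)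
qed

lemma pmf_joint_law_pos:
  assumes "\<omega> \<in> set_pmf P"
  shows "pmf (joint_law P X J) (joint_rv X J \<omega>) > 0"
  using assms by (auto simp: joint_law_def pmf_positive)

text \<open>Finite entropy is an integrability condition against counting measure on
  \<open>J \<rightarrow>\<^sub>E UNIV\<close>. Carried over to the sample space, it exhibits entropy
  as the mean of \<open>info\<close>, to which the law of large numbers applies.\<close>

lemma
  fixes X :: "'k \<Rightarrow> 'o \<Rightarrow> 'v::countable"
  assumes "finite_joint_entropy P X J"
  shows integrable_info: "integrable (measure_pmf P) (info P X J)"
    and joint_entropy_eq_info: "joint_entropy P X J = measure_pmf.expectation P (info P X J)"
proof -
  interpret information_space "measure_pmf P" 2
    by unfold_locales auto
  let ?N = "count_space (J \<rightarrow>\<^sub>E (UNIV :: 'v set))" and ?f = "pmf (joint_law P X J)"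
  have D: "distributed (measure_pmf P) ?N (joint_rv X J) ?f"
    and I: "integrable ?N (\<lambda>x. ?f x * log 2 (?f x))"
    using assms by (auto simp: finite_joint_entropy_def finite_entropy_def)
  have "integrable (measure_pmf P) (\<lambda>\<omega>. log 2 (?f (joint_rv X J \<omega>)))"
    using distributed_integrable[OF D, of "\<lambda>x. log 2 (?f x)"] I by simp
  then show "integrable (measure_pmf P) (info P X J)"
    unfolding info_def by simp
  show "joint_entropy P X J = measure_pmf.expectation P (info P X J)"
    unfolding joint_entropy_def info_def
    using entropy_distr[OF D] distributed_integral[OF D, of "\<lambda>x. log 2 (?f x)"] by simp
qed

lemma distributed_pmf_count_space:
  "distributed (measure_pmf P) (count_space UNIV) Z (pmf (map_pmf Z P))"
  unfolding distributed_def by (simp flip: map_pmf_rep_eq measure_pmf_eq_density)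

text \<open>The chain rule. The library's version concerns a pair-valued variable, while
  \<open>joint_entropy\<close> concerns a function on the index set; evaluated at a sample the two
  mass functions agree, so both are compared as means of \<open>info\<close>.\<close>

lemma cond_entropy_eq_joint_entropy:
  fixes X :: "'k \<Rightarrow> 'o \<Rightarrow> 'v::countable"
  assumes ab: "finite_joint_entropy P X {a, b}" and b: "finite_joint_entropy P X {b}"
  shows "cond_entropy P (X a) (X b) = joint_entropy P X {a, b} - joint_entropy P X {b}"
proof -
  interpret information_space "measure_pmf P" 2
    by unfold_locales auto
  let ?C = "count_space (UNIV :: 'v set)"
  have CC: "?C \<Otimes>\<^sub>M ?C = count_space UNIV"
    by (simp add: pair_measure_countable)
  let ?Z = "\<lambda>\<omega>. (X a \<omega>, X b \<omega>)"
  let ?f = "pmf (map_pmf ?Z P)" and ?g = "pmf (map_pmf (X b) P)"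
  have Dg: "distributed (measure_pmf P) ?C (X b) ?g"
    by (rule distributed_pmf_count_space)
  have Df: "distributed (measure_pmf P) (?C \<Otimes>\<^sub>M ?C) ?Z ?f"
    unfolding CC by (rule distributed_pmf_count_space)
  have f: "?f (?Z \<omega>) = pmf (joint_law P X {a, b}) (joint_rv X {a, b} \<omega>)" for \<omega>
    unfolding pmf_joint_law pmf_map by (rule arg_cong[where f = "measure_pmf.prob P"]) auto
  have g: "?g (X b \<omega>) = pmf (joint_law P X {b}) (joint_rv X {b} \<omega>)" for \<omega>
    unfolding pmf_joint_law pmf_map by (rule arg_cong[where f = "measure_pmf.prob P"]) auto
  have Lf: "(\<lambda>\<omega>. log 2 (?f (?Z \<omega>))) = (\<lambda>\<omega>. - info P X {a, b} \<omega>)"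
    by (simp add: f info_def)
  have Lg: "(\<lambda>\<omega>. log 2 (?g (X b \<omega>))) = (\<lambda>\<omega>. - info P X {b} \<omega>)"
    by (simp add: g info_def)
  have I1: "integrable (?C \<Otimes>\<^sub>M ?C) (\<lambda>z. ?f z * log 2 (?f z))"
    using distributed_integrable[OF Df, of "\<lambda>z. log 2 (?f z)"] integrable_info[OF ab]
    by (simp add: Lf CC)
  have I2: "integrable (?C \<Otimes>\<^sub>M ?C) (\<lambda>z. ?f z * log 2 (?g (snd z)))"
    using distributed_integrable[OF Df, of "\<lambda>z. log 2 (?g (snd z))"] integrable_info[OF b]
    by (simp add: Lg CC)
  have "cond_entropy P (X a) (X b) = prob_space.entropy (measure_pmf P) 2 (?C \<Otimes>\<^sub>M ?C) ?Z - prob_space.entropy (measure_pmf P) 2 ?C (X b)"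
    unfolding cond_entropy_def
    by (rule conditional_entropy_eq_entropy[OF _ _ Dg _ Df _ I1 I2])
      (auto intro: sigma_finite_measure_count_space_countable)
  also have "prob_space.entropy (measure_pmf P) 2 (?C \<Otimes>\<^sub>M ?C) ?Z = measure_pmf.expectation P (info P X {a, b})"
    using entropy_distr[OF Df] distributed_integral[OF Df, of "\<lambda>z. log 2 (?f z)"] by (simp add: Lf CC)
  also have "prob_space.entropy (measure_pmf P) 2 ?C (X b) = measure_pmf.expectation P (info P X {b})"
    using entropy_distr[OF Dg] distributed_integral[OF Dg, of "\<lambda>z. log 2 (?g z)"] by (simp add: Lg)
  finally show ?thesis
    by (simp add: joint_entropy_eq_info ab b)
qed

section \<open>Probabilities of sequences and typical sequences\<close>

definition samples :: "('k \<Rightarrow> 'o \<Rightarrow> 'v) \<Rightarrow> nat \<Rightarrow> (nat \<Rightarrow> 'o) \<Rightarrow> 'k \<Rightarrow> 'v list" where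
  "samples X n \<omega> k = map (\<lambda>i. X k (\<omega> i)) [0..<n]"

lemma seq_prob_samples:
  "seq_prob P X J n (samples X n \<omega>) = (\<Prod>i<n. pmf (joint_law P X J) (joint_rv X J (\<omega> i)))"
  unfolding seq_prob_def
  by (intro prod.cong refl arg_cong[where f = "pmf _"]) (auto simp: samples_def joint_rv_def)

lemma seq_prob_cong:
  assumes "\<And>k i. k \<in> J \<Longrightarrow> i < n \<Longrightarrow> x k ! i = y k ! i"
  shows "seq_prob P X J n x = seq_prob P X J n y"
  unfolding seq_prob_def
  by (intro prod.cong refl arg_cong[where f = "pmf _"]) (use assms in \<open>auto simp: fun_eq_iff restrict_def\<close>)

lemma typical_set_cong:
  assumes "\<And>k. k \<in> K \<Longrightarrow> x k = y k"
  shows "x \<in> typical_set P X K n \<epsilon> \<longleftrightarrow> y \<in> typical_set P X K n \<epsilon>"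
proof -
  have "seq_prob P X J n x = seq_prob P X J n y" if "J \<subseteq> K" for J
    using assms that by (intro seq_prob_cong) auto
  then show ?thesis using assms by (auto simp: typical_set_def)
qed

lemma typical_set_mono:
  "x \<in> typical_set P X K n \<epsilon> \<Longrightarrow> I \<subseteq> K \<Longrightarrow> x \<in> typical_set P X I n \<epsilon>"
  unfolding typical_set_def mem_Collect_eq by (meson subset_trans subsetD)

text \<open>The logarithm turns \<open>seq_prob\<close> into a sum of \<open>info\<close> terms.
  Samples in the support have factors of positive mass, which supplies the positivity clause of
  \<open>typical_set\<close> and the splitting of the logarithm.\<close>

lemma samples_typicalI:
  assumes "\<And>i. i < n \<Longrightarrow> \<omega> i \<in> set_pmf P"
    and "\<And>J. J \<subseteq> K \<Longrightarrow> J \<noteq> {} \<Longrightarrow> \<bar>(\<Sum>i<n. info P X J (\<omega> i)) / real n - joint_entropy P X J\<bar> \<le> \<epsilon>"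
  shows "samples X n \<omega> \<in> typical_set P X K n \<epsilon>"
proof -
  have pos: "pmf (joint_law P X J) (joint_rv X J (\<omega> i)) > 0" if "i < n" for i J
    using assms(1)[OF that] by (rule pmf_joint_law_pos)
  have "- (1 / real n) * log 2 (seq_prob P X J n (samples X n \<omega>)) = (\<Sum>i<n. info P X J (\<omega> i)) / real n" for J
    unfolding seq_prob_samples log_def
    by (subst ln_prod) (use pos[THEN less_imp_neq] in \<open>auto simp: info_def log_def sum_negf sum_divide_distrib\<close>)
  moreover have "seq_prob P X J n (samples X n \<omega>) > 0" for J
    unfolding seq_prob_samples using pos by (intro prod_pos) auto
  ultimately show ?thesis
    using assms(2) by (auto simp: typical_set_def samples_def)
qed

lemma
  assumes "x \<in> typical_set P X K n \<epsilon>" "J \<subseteq> K" "J \<noteq> {}" "n > 0"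
  shows typical_seq_prob_lower: "2 powr (- (real n * (joint_entropy P X J + \<epsilon>))) \<le> seq_prob P X J n x"
    and typical_seq_prob_upper: "seq_prob P X J n x \<le> 2 powr (- (real n * (joint_entropy P X J - \<epsilon>)))"
proof -
  let ?p = "seq_prob P X J n x"
  have p: "0 < ?p" "\<bar>- (1 / real n) * log 2 ?p - joint_entropy P X J\<bar> \<le> \<epsilon>"
    using assms by (auto simp: typical_set_def)
  have "- (log 2 ?p / real n) \<le> joint_entropy P X J + \<epsilon>" "joint_entropy P X J - \<epsilon> \<le> - (log 2 ?p / real n)"
    using p(2) by (auto simp: abs_le_iff)
  then have "- (real n * (joint_entropy P X J + \<epsilon>)) \<le> log 2 ?p"
      "log 2 ?p \<le> - (real n * (joint_entropy P X J - \<epsilon>))"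
    using \<open>n > 0\<close> by (auto simp: field_simps)
  then show "2 powr (- (real n * (joint_entropy P X J + \<epsilon>))) \<le> ?p"
      "?p \<le> 2 powr (- (real n * (joint_entropy P X J - \<epsilon>)))"
    using p(1) by (simp_all add: le_log_iff log_le_iff)
qed

text \<open>As events of one product space, sequence probabilities can be added and compared by
  disjointness and inclusion.\<close>

lemma seq_prob_eq_measure:
  "seq_prob P X J n x =
     measure_pmf.prob (Pi_pmf {..<n} d (\<lambda>_. P)) {\<omega>. \<forall>i<n. \<forall>k\<in>J. X k (\<omega> i) = x k ! i}"
proof -
  have "pmf (joint_law P X J) (\<lambda>k\<in>J. x k ! i) = measure_pmf.prob P {\<omega>. \<forall>k\<in>J. X k \<omega> = x k ! i}" for i
    unfolding joint_law_def pmf_map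
    by (rule arg_cong[where f = "measure_pmf.prob P"])
      (auto simp: joint_rv_def fun_eq_iff, metis restrict_apply')
  then have "seq_prob P X J n x = (\<Prod>i<n. measure_pmf.prob P {\<omega>. \<forall>k\<in>J. X k \<omega> = x k ! i})"
    by (simp add: seq_prob_def)
  also have "\<dots> = measure_pmf.prob (Pi_pmf {..<n} d (\<lambda>_. P)) (Pi {..<n} (\<lambda>i. {\<omega>. \<forall>k\<in>J. X k \<omega> = x k ! i}))"
    by (rule measure_Pi_pmf_Pi[symmetric]) simp
  also have "Pi {..<n} (\<lambda>i. {\<omega>. \<forall>k\<in>J. X k \<omega> = x k ! i}) = {\<omega>. \<forall>i<n. \<forall>k\<in>J. X k (\<omega> i) = x k ! i}"
    by auto
  finally show ?thesis .
qed

text \<open>The events that prescribe the sequences of \<open>J\<close> are disjoint for different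
  members of \<open>A\<close>, and each lies inside the event that prescribes the common sequences
  of \<open>I\<close>.\<close>

lemma sum_seq_prob_le:
  assumes "finite A" "I \<subseteq> J"
    and agree: "\<And>a k i. a \<in> A \<Longrightarrow> k \<in> I \<Longrightarrow> i < n \<Longrightarrow> x a k ! i = y k ! i"
    and distinct: "\<And>a b. a \<in> A \<Longrightarrow> b \<in> A \<Longrightarrow> (\<And>k i. k \<in> J \<Longrightarrow> i < n \<Longrightarrow> x a k ! i = x b k ! i) \<Longrightarrow> a = b"
  shows "(\<Sum>a\<in>A. seq_prob P X J n (x a)) \<le> seq_prob P X I n y"
proof -
  let ?Q = "Pi_pmf {..<n} undefined (\<lambda>_. P)"
  let ?E = "\<lambda>J x. {\<omega>. \<forall>i<n. \<forall>k\<in>J. X k (\<omega> i) = x k ! i}"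
  have "(\<Sum>a\<in>A. seq_prob P X J n (x a)) = (\<Sum>a\<in>A. measure_pmf.prob ?Q (?E J (x a)))"
    unfolding seq_prob_eq_measure[of P X J n _ undefined] ..
  also have "\<dots> = measure_pmf.prob ?Q (\<Union>a\<in>A. ?E J (x a))"
  proof (rule measure_pmf.finite_measure_finite_Union[symmetric])
    show "disjoint_family_on (\<lambda>a. ?E J (x a)) A"
      unfolding disjoint_family_on_def
    proof (intro ballI impI equals0I)
      fix a b \<omega> assume "a \<in> A" "b \<in> A" "a \<noteq> b" and "\<omega> \<in> ?E J (x a) \<inter> ?E J (x b)"
      then have E: "\<omega> \<in> ?E J (x a)" "\<omega> \<in> ?E J (x b)" by auto
      have "x a k ! i = x b k ! i" if "k \<in> J" "i < n" for k i
        using E that by (metis (mono_tags, lifting) mem_Collect_eq)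
      then have "a = b" using \<open>a \<in> A\<close> \<open>b \<in> A\<close> by (intro distinct)
      with \<open>a \<noteq> b\<close> show False by simp
    qed
  qed (use assms(1) in auto)
  also have "\<dots> \<le> measure_pmf.prob ?Q (?E I y)"
    using agree \<open>I \<subseteq> J\<close> by (intro measure_pmf.finite_measure_mono) fastforce+
  also have "\<dots> = seq_prob P X I n y"
    by (rule seq_prob_eq_measure[symmetric])
  finally show ?thesis .
qed

text \<open>Each extension has probability at least
  \<open>2 powr (- n * (H(J) + \<epsilon>))\<close>, and together they have at most that of the
  common part, \<open>2 powr (- n * (H(I) - \<epsilon>))\<close>. The two tolerances add up to
  \<open>2 * \<epsilon>\<close>.\<close>

lemma card_typical_extensions_le:
  assumes "finite A" "I \<subseteq> J" "I \<noteq> {}" "n > 0"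
    and typical: "\<And>a. a \<in> A \<Longrightarrow> x a \<in> typical_set P X J n \<epsilon>"
    and agree: "\<And>a k i. a \<in> A \<Longrightarrow> k \<in> I \<Longrightarrow> i < n \<Longrightarrow> x a k ! i = y k ! i"
    and distinct: "\<And>a b. a \<in> A \<Longrightarrow> b \<in> A \<Longrightarrow> (\<And>k i. k \<in> J \<Longrightarrow> i < n \<Longrightarrow> x a k ! i = x b k ! i) \<Longrightarrow> a = b"
  shows "real (card A) \<le> 2 powr (real n * (joint_entropy P X J - joint_entropy P X I + 2 * \<epsilon>))"
proof (cases "A = {}")
  case False
  \<comment> \<open>Typicality of the common part is inherited from a member of \<open>A\<close>;
    nothing of the kind is assumed of \<open>y\<close> itself.\<close>
  then obtain a where a: "a \<in> A" by blast
  let ?l = "2 powr (- (real n * (joint_entropy P X J + \<epsilon>)))"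
  have "real (card A) * ?l = (\<Sum>a\<in>A. ?l)" by simp
  also have "\<dots> \<le> (\<Sum>a\<in>A. seq_prob P X J n (x a))"
    using assms by (intro sum_mono typical_seq_prob_lower[where K = J] typical) auto
  also have "\<dots> \<le> seq_prob P X I n (x a)"
    using assms(1,2) agree distinct a by (intro sum_seq_prob_le) auto
  also have "\<dots> \<le> 2 powr (- (real n * (joint_entropy P X I - \<epsilon>)))"
    by (rule typical_seq_prob_upper[OF typical[OF a] assms(2-4)])
  finally have "real (card A) \<le> 2 powr (- (real n * (joint_entropy P X I - \<epsilon>))) / ?l"
    by (simp add: field_simps)
  also have "\<dots> = 2 powr (real n * (joint_entropy P X J - joint_entropy P X I + 2 * \<epsilon>))"
    by (simp add: powr_diff[symmetric] algebra_simps)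
  finally show ?thesis .
qed simp

text \<open>The asymptotic equipartition property: the weak law for each \<open>info P X J\<close>,
  and a union bound over the finitely many nonempty \<open>J \<subseteq> K\<close>.\<close>

lemma prob_not_typical_tendsto:
  fixes X :: "'k \<Rightarrow> 'o \<Rightarrow> 'v::countable"
  assumes K: "finite K" and fe: "\<And>J. J \<subseteq> K \<Longrightarrow> J \<noteq> {} \<Longrightarrow> finite_joint_entropy P X J" and "\<epsilon> > 0"
  shows "(\<lambda>n. measure_pmf.prob (Pi_pmf {..<n} d (\<lambda>_. P))
           {\<omega>. samples X n \<omega> \<notin> typical_set P X K n \<epsilon>}) \<longlonglongrightarrow> 0"
proof -
  let ?Q = "\<lambda>n. Pi_pmf {..<n} d (\<lambda>_. P)"
  let ?E = "\<lambda>n J. {\<omega>. \<epsilon> < \<bar>(\<Sum>i<n. info P X J (\<omega> i)) / real n - measure_pmf.expectation P (info P X J)\<bar>}"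
  let ?I = "Pow K - {{}}"
  have "(\<lambda>n. \<Sum>J\<in>?I. measure_pmf.prob (?Q n) (?E n J)) \<longlonglongrightarrow> (\<Sum>J\<in>?I. 0)"
    using assms by (intro tendsto_sum weak_law_Pi_pmf integrable_info) auto
  then have lim: "(\<lambda>n. \<Sum>J\<in>?I. measure_pmf.prob (?Q n) (?E n J)) \<longlonglongrightarrow> 0" by simp
  have "measure_pmf.prob (?Q n) {\<omega>. samples X n \<omega> \<notin> typical_set P X K n \<epsilon>}
      \<le> (\<Sum>J\<in>?I. measure_pmf.prob (?Q n) (?E n J))" for n
  proof -
    have "measure_pmf.prob (?Q n) {\<omega>. samples X n \<omega> \<notin> typical_set P X K n \<epsilon>}
        \<le> measure_pmf.prob (?Q n) (\<Union>J\<in>?I. ?E n J)"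
    proof (rule measure_pmf.finite_measure_mono_AE)
      \<comment> \<open>The inclusion is claimed only almost everywhere: outside the support a
        sample may violate the positivity clause without any deviation of the averages.\<close>
      show "AE \<omega> in measure_pmf (?Q n). \<omega> \<in> {\<omega>. samples X n \<omega> \<notin> typical_set P X K n \<epsilon>}
          \<longrightarrow> \<omega> \<in> (\<Union>J\<in>?I. ?E n J)"
      proof (rule AE_pmfI, rule impI, rule ccontr)
        fix \<omega> assume \<omega>: "\<omega> \<in> set_pmf (?Q n)"
          and "\<omega> \<in> {\<omega>. samples X n \<omega> \<notin> typical_set P X K n \<epsilon>}" "\<omega> \<notin> (\<Union>J\<in>?I. ?E n J)"
        moreover have "\<omega> i \<in> set_pmf P" if "i < n" for i
          using \<omega> that by (auto simp: set_Pi_pmf PiE_dflt_def)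
        ultimately show False
          using samples_typicalI[of n \<omega> P K X \<epsilon>] fe by (force simp: joint_entropy_eq_info not_less)
      qed
    qed simp
    also have "\<dots> \<le> (\<Sum>J\<in>?I. measure_pmf.prob (?Q n) (?E n J))"
      using K by (intro measure_pmf.finite_measure_subadditive_finite) auto
    finally show ?thesis .
  qed
  then show ?thesis
    by (intro tendsto_sandwich[OF _ _ tendsto_const lim]) auto
qed

section \<open>Channel outputs given the bit labels\<close>

lemma prob_bind_pmf:
  "measure_pmf.prob (bind_pmf p K) B = measure_pmf.expectation p (\<lambda>b. measure_pmf.prob (K b) B)"
  unfolding measure_pmf_bind
  by (rule measure_pmf.measure_bind[where N = "count_space UNIV"])
    (use measurable_measure_pmf[of K] in \<open>simp_all cong: measurable_cong_sets\<close>)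

text \<open>On the supports, \<open>A\<close> singles out the component \<open>b\<close> of the
  mixture. A set inside \<open>A\<close> therefore has mixture probability \<open>pmf p b\<close>
  times its probability under \<open>K b\<close>, and conditioning on \<open>A\<close> divides by
  \<open>pmf p b\<close>.\<close>

lemma cond_pmf_bind:
  assumes b: "b \<in> set_pmf p"
    and A: "\<And>b' x. b' \<in> set_pmf p \<Longrightarrow> x \<in> set_pmf (K b') \<Longrightarrow> x \<in> A \<longleftrightarrow> b' = b"
  shows "cond_pmf (bind_pmf p K) A = K b"
proof -
  obtain x0 where x0: "x0 \<in> set_pmf (K b)" using set_pmf_not_empty[of "K b"] by blast
  have ne: "set_pmf (bind_pmf p K) \<inter> A \<noteq> {}"
    using b x0 A[OF b x0] by auto
  have prob: "measure_pmf.prob (bind_pmf p K) B = pmf p b * measure_pmf.prob (K b) B" if "B \<subseteq> A" for B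
  proof -
    have "measure_pmf.prob (bind_pmf p K) B
        = measure_pmf.expectation p (\<lambda>b'. measure_pmf.prob (K b') B)"
      by (rule prob_bind_pmf)
    also have "\<dots> = measure_pmf.expectation p (\<lambda>b'. measure_pmf.prob (K b) B * indicator {b} b')"
    proof (intro integral_cong_AE AE_pmfI)
      fix b' assume b': "b' \<in> set_pmf p"
      show "measure_pmf.prob (K b') B = measure_pmf.prob (K b) B * indicator {b} b'"
      proof (cases "b' = b")
        case False
        then have "set_pmf (K b') \<inter> B = {}" using A[OF b'] that by auto
        then show ?thesis using False by (simp add: measure_pmf_zero_iff)
      qed simp
    qed auto
    also have "\<dots> = measure_pmf.prob (K b) B * pmf p b"
      by (simp add: measure_pmf_single)
    finally show ?thesis by simp
  qed
  have "set_pmf (K b) \<subseteq> A" using A[OF b] by auto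
  then have 1: "measure_pmf.prob (K b) A = 1"
    by (simp add: measure_pmf.prob_eq_1 AE_measure_pmf_iff subset_iff)
  have pos: "pmf p b > 0" using b by (rule pmf_positive)
  show ?thesis
  proof (rule pmf_eqI)
    fix x
    show "pmf (cond_pmf (bind_pmf p K) A) x = pmf (K b) x"
    proof (cases "x \<in> A")
      case True
      have "pmf (bind_pmf p K) x = pmf p b * pmf (K b) x"
        using prob[of "{x}"] True by (simp add: measure_pmf_single)
      then show ?thesis
        using True prob[of A] 1 pos by (simp add: pmf_cond[OF ne])
    next
      case False
      then have "pmf (K b) x = 0" using A[OF b] by (auto simp: pmf_eq_0_set_pmf)
      then show ?thesis using False by (simp add: pmf_cond[OF ne])
    qed
  qed
qed

text \<open>By linearity the sum is the expected number of \<open>a\<close> related to the random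
  \<open>y\<close>, and the bound holds for that number at every \<open>y\<close> in the
  support.\<close>

lemma sum_prob_le_card:
  assumes "finite A" and "\<And>y. y \<in> set_pmf L \<Longrightarrow> real (card {a \<in> A. R a y}) \<le> c"
  shows "(\<Sum>a\<in>A. measure_pmf.prob L {y. R a y}) \<le> c"
proof -
  have "(\<Sum>a\<in>A. measure_pmf.prob L {y. R a y})
      = (\<Sum>a\<in>A. measure_pmf.expectation L (indicator {y. R a y}))"
    by simp
  also have "\<dots> = measure_pmf.expectation L (\<lambda>y. \<Sum>a\<in>A. indicator {y. R a y} y)"
    by (rule Bochner_Integration.integral_sum[symmetric])
      (auto intro!: integrable_real_indicator simp: measure_pmf.emeasure_eq_measure)
  also have "\<dots> \<le> c"
  proof (rule measure_pmf.integral_le_const)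
    show "AE y in measure_pmf L. (\<Sum>a\<in>A. indicator {y. R a y} y) \<le> c"
    proof (rule AE_pmfI)
      fix y assume y: "y \<in> set_pmf L"
      have "(\<Sum>a\<in>A. indicator {y. R a y} y) = real (card {a \<in> A. R a y})"
        using assms(1) by (simp add: indicator_def sum.If_cases Int_def)
      then show "(\<Sum>a\<in>A. indicator {y. R a y} y) \<le> c" using assms(2)[OF y] by simp
    qed
  qed (auto intro!: Bochner_Integration.integrable_sum integrable_real_indicator
        simp: measure_pmf.emeasure_eq_measure)
  finally show ?thesis .
qed

section \<open>Uniform sign sequences, and signs with outputs given the bits\<close>

lemma finite_signs [simp]: "finite signs" and signs_nonempty [simp]: "signs \<noteq> {}"
  and card_signs: "card signs = 2"
  by (auto simp: signs_def)

lemma sign_seqs_eq: "sign_seqs n = {s. set s \<subseteq> signs \<and> length s = n}"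
  by (auto simp: sign_seqs_def)

lemma finite_sign_seqs: "finite (sign_seqs n)"
  unfolding sign_seqs_eq by (rule finite_lists_length_eq) simp

lemma card_sign_seqs: "card (sign_seqs n) = 2 ^ n"
  unfolding sign_seqs_eq by (simp add: card_lists_length_eq card_signs)

lemma sign_seqs_nonempty: "sign_seqs n \<noteq> {}"
  using card_sign_seqs[of n] by auto

lemma bij_betw_append_sign_seqs:
  "bij_betw (\<lambda>(s, t). s @ t) (sign_seqs k \<times> sign_seqs l) (sign_seqs (k + l))"
proof (rule bij_betw_byWitness[where f' = "\<lambda>s. (take k s, drop k s)"])
  show "(\<lambda>s. (take k s, drop k s)) ` sign_seqs (k + l) \<subseteq> sign_seqs k \<times> sign_seqs l"
    by (auto simp: sign_seqs_def dest: in_set_takeD in_set_dropD)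
qed (auto simp: sign_seqs_def)

lemma pmf_of_set_sign_seqs:
  "pmf_of_set (sign_seqs n)
    = map_pmf (\<lambda>s. map s [0..<n]) (Pi_pmf {..<n} undefined (\<lambda>_. pmf_of_set signs))"
proof -
  let ?D = "PiE_dflt {..<n} undefined (\<lambda>_. signs)"
  have inj: "inj_on (\<lambda>s. map s [0..<n]) ?D"
    by (auto simp: inj_on_def PiE_dflt_def fun_eq_iff)
  have img: "(\<lambda>s. map s [0..<n]) ` ?D = sign_seqs n"
  proof (intro equalityI subsetI)
    fix l assume l: "l \<in> sign_seqs n"
    show "l \<in> (\<lambda>s. map s [0..<n]) ` ?D"
    proof (rule image_eqI)
      show "l = map (\<lambda>i. if i < n then l ! i else undefined) [0..<n]"
        using l by (auto simp: sign_seqs_def intro: nth_equalityI)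
      show "(\<lambda>i. if i < n then l ! i else undefined) \<in> ?D"
        using l by (auto simp: sign_seqs_def PiE_dflt_def)
    qed
  qed (auto simp: sign_seqs_def PiE_dflt_def)
  have "Pi_pmf {..<n} undefined (\<lambda>_. pmf_of_set signs) = pmf_of_set ?D"
    by (rule Pi_pmf_of_set) auto
  then show ?thesis
    using map_pmf_of_set_inj[OF inj] img by (simp add: PiE_dflt_empty_iff finite_PiE_dflt)
qed

text \<open>The conditional law of the whole sample given the label \<open>b\<close>;
  \<open>source_channel_law\<close> is its mixture over \<open>p\<close>. The label stays in the
  outcome so that a sample reveals its component.\<close>

definition given_bits :: "(bool list \<Rightarrow> int) \<Rightarrow> (int \<Rightarrow> 'y pmf) \<Rightarrow> bool list \<Rightarrow> (bool list \<times> int \<times> 'y) pmf"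
  where "given_bits f W b = do {
    s \<leftarrow> pmf_of_set signs;
    y \<leftarrow> W (s * f b);
    return_pmf (b, s, y)
  }"

lemma source_channel_law_eq_bind: "source_channel_law f W p = bind_pmf p (given_bits f W)"
  unfolding source_channel_law_def given_bits_def ..

lemma set_given_bits: "x \<in> set_pmf (given_bits f W b) \<Longrightarrow> fst x = b"
  by (auto simp: given_bits_def)

text \<open>The two draws inside \<open>given_bits\<close> can be taken out of the product law,
  first all signs and then all outputs. This is the link between the conditional law in the
  B-typical set and the transmission of a codeword with uniformly random signs.\<close>

lemma Pi_given_bits:
  "map_pmf (\<lambda>\<omega>. (map (\<lambda>i. fst (snd (\<omega> i))) [0..<n], map (\<lambda>i. snd (snd (\<omega> i))) [0..<n]))
     (Pi_pmf {..<n} undefined (\<lambda>i. given_bits f W (b i)))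
   = do {
       s \<leftarrow> pmf_of_set (sign_seqs n);
       y \<leftarrow> memoryless W (map (\<lambda>i. s ! i * f (b i)) [0..<n]);
       return_pmf (s, y)
     }" (is "map_pmf ?g _ = _")
proof -
  have "Pi_pmf {..<n} undefined (\<lambda>i. given_bits f W (b i))
      = do {
          s \<leftarrow> Pi_pmf {..<n} undefined (\<lambda>_. pmf_of_set signs);
          y \<leftarrow> Pi_pmf {..<n} undefined (\<lambda>i. W (s i * f (b i)));
          return_pmf (\<lambda>i. if i < n then (b i, s i, y i) else undefined)
        }"
    unfolding given_bits_def
    by (simp add: Pi_pmf_bind[where d' = undefined])
  then have "map_pmf ?g (Pi_pmf {..<n} undefined (\<lambda>i. given_bits f W (b i)))
      = do {
          s \<leftarrow> Pi_pmf {..<n} undefined (\<lambda>_. pmf_of_set signs);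
          y \<leftarrow> Pi_pmf {..<n} undefined (\<lambda>i. W (s i * f (b i)));
          return_pmf (map s [0..<n], map y [0..<n])
        }"
    by (simp add: map_bind_pmf) (intro bind_pmf_cong refl, auto)
  also have "\<dots> = do {
          s \<leftarrow> Pi_pmf {..<n} undefined (\<lambda>_. pmf_of_set signs);
          y \<leftarrow> memoryless W (map (\<lambda>i. map s [0..<n] ! i * f (b i)) [0..<n]);
          return_pmf (map s [0..<n], y)
        }"
  proof (intro bind_pmf_cong refl)
    fix s
    have "Pi_pmf {..<n} undefined (\<lambda>i. W (map (\<lambda>i. map s [0..<n] ! i * f (b i)) [0..<n] ! i))
        = Pi_pmf {..<n} undefined (\<lambda>i. W (s i * f (b i)))"
      by (rule Pi_pmf_cong) auto
    then show "do {
          y \<leftarrow> Pi_pmf {..<n} undefined (\<lambda>i. W (s i * f (b i)));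
          return_pmf (map s [0..<n], map y [0..<n])
        } = do {
          y \<leftarrow> memoryless W (map (\<lambda>i. map s [0..<n] ! i * f (b i)) [0..<n]);
          return_pmf (map s [0..<n], y)
        }"
      by (simp add: memoryless_def bind_map_pmf)
  qed
  finally show ?thesis
    by (simp add: pmf_of_set_sign_seqs bind_map_pmf)
qed

section \<open>The B-typical set as a codebook\<close>

locale bit_channel =
  fixes m :: nat and f :: "bool list \<Rightarrow> int" and W :: "int \<Rightarrow> 'y::countable pmf"
    and p :: "bool list pmf"
  assumes m_pos: "m \<ge> 1" and bits: "set_pmf p \<subseteq> labels m"
    and finite_entropy: "\<And>J. J \<subseteq> all_vars m \<Longrightarrow> J \<noteq> {} \<Longrightarrow>
      finite_joint_entropy (source_channel_law f W p) rv J"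
begin

abbreviation P :: "(bool list \<times> int \<times> 'y) pmf" where
  "P \<equiv> source_channel_law f W p"

abbreviation H :: "var set \<Rightarrow> real" where
  "H \<equiv> joint_entropy P rv"

text \<open>Codewords are stored by bit level; \<open>column\<close> reads off the label of one
  channel use, and \<open>rows\<close> transposes a sequence of labels into this form.\<close>

definition column :: "bool list list \<Rightarrow> nat \<Rightarrow> bool list" where
  "column t i = map (\<lambda>j. t ! j ! i) [0..<m]"

definition rows :: "nat \<Rightarrow> (nat \<Rightarrow> bool list) \<Rightarrow> bool list list" where
  "rows n b = map (\<lambda>j. map (\<lambda>i. b i ! j) [0..<n]) [0..<m]"

text \<open>Typicality of the bit variables inspects only the first \<open>m\<close> rows, so the
  length condition makes the list representing a tuple unique, and the set finite.\<close>

definition codebook :: "nat \<Rightarrow> real \<Rightarrow> bool list list set" where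
  "codebook n \<epsilon> = {t. length t = m \<and>
     var_seqs t [] [] \<in> B_typical_set P rv (bit_vars m) {SVar, YVar} n \<epsilon>}"

lemma length_bits: "b \<in> set_pmf p \<Longrightarrow> length b = m"
  using bits by (auto simp: labels_def)

lemma set_P: "\<omega> \<in> set_pmf P \<Longrightarrow> fst \<omega> \<in> set_pmf p"
  unfolding source_channel_law_eq_bind by (auto dest: set_given_bits)

lemma column_rows: "i < n \<Longrightarrow> length (b i) = m \<Longrightarrow> column (rows n b) i = b i"
  by (auto simp: column_def rows_def intro: nth_equalityI)

lemma codebook_typical:
  "t \<in> codebook n \<epsilon> \<Longrightarrow> var_seqs t [] [] \<in> typical_set P rv (bit_vars m) n \<epsilon>"
  by (simp add: codebook_def B_typical_set_def)

lemma codebook_length: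
  assumes "t \<in> codebook n \<epsilon>"
  shows "length t = m" and "j < m \<Longrightarrow> length (t ! j) = n"
proof -
  show "length t = m" using assms by (simp add: codebook_def)
  have "length (var_seqs t [] [] (BVar j)) = n" if "j < m"
    using codebook_typical[OF assms] that by (simp add: typical_set_def bit_vars_def)
  then show "j < m \<Longrightarrow> length (t ! j) = n" by simp
qed

lemma codebook_subset:
  "codebook n \<epsilon> \<subseteq> {t. set t \<subseteq> {l. set l \<subseteq> UNIV \<and> length l = n} \<and> length t = m}"
proof
  fix t assume t: "t \<in> codebook n \<epsilon>"
  have "length l = n" if "l \<in> set t" for l
    using that codebook_length[OF t] by (auto simp: in_set_conv_nth)
  then show "t \<in> {t. set t \<subseteq> {l. set l \<subseteq> UNIV \<and> length l = n} \<and> length t = m}"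
    using codebook_length(1)[OF t] by auto
qed

lemma finite_codebook: "finite (codebook n \<epsilon>)"
  by (rule finite_subset[OF codebook_subset]) (intro finite_lists_length_eq, simp)

lemma card_codebook_le: "card (codebook n \<epsilon>) \<le> (2 ^ n) ^ m"
proof -
  have "finite {l :: bool list. set l \<subseteq> UNIV \<and> length l = n}"
    by (intro finite_lists_length_eq) simp
  then have "card {t. set t \<subseteq> {l :: bool list. set l \<subseteq> UNIV \<and> length l = n} \<and> length t = m} = (2 ^ n) ^ m"
    using card_lists_length_eq[of "UNIV :: bool set" n] by (subst card_lists_length_eq) auto
  moreover have "card (codebook n \<epsilon>)
      \<le> card {t. set t \<subseteq> {l :: bool list. set l \<subseteq> UNIV \<and> length l = n} \<and> length t = m}"
    by (rule card_mono[OF _ codebook_subset]) (intro finite_lists_length_eq, simp)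
  ultimately show ?thesis by simp
qed

text \<open>Labels in the support of \<open>p\<close> have length \<open>m\<close>, so agreement in
  \<open>m\<close> bits is equality, and the conditioning event at position \<open>i\<close> selects
  exactly one component of the mixture.\<close>

lemma cond_samples_eq:
  assumes t: "length t = m" "\<And>j. j < m \<Longrightarrow> length (t ! j) = n"
    and col: "\<And>i. i < n \<Longrightarrow> column t i \<in> set_pmf p"
  shows "cond_samples P rv (bit_vars m) n (var_seqs t [] [])
    = Pi_pmf {..<n} undefined (\<lambda>i. given_bits f W (column t i))"
  unfolding cond_samples_def
proof (rule Pi_pmf_cong)
  fix i assume "i \<in> {..<n}"
  then have i: "i < n" by simp
  show "cond_pmf P {\<omega>. \<forall>k\<in>bit_vars m. rv k \<omega> = var_seqs t [] [] k ! i} = given_bits f W (column t i)"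
    unfolding source_channel_law_eq_bind
  proof (rule cond_pmf_bind[OF col[OF i]])
    fix b' x assume b': "b' \<in> set_pmf p" and x: "x \<in> set_pmf (given_bits f W b')"
    obtain s y where xe: "x = (b', s, y)" using set_given_bits[OF x] by (cases x) auto
    have "x \<in> {\<omega>. \<forall>k\<in>bit_vars m. rv k \<omega> = var_seqs t [] [] k ! i} \<longleftrightarrow> (\<forall>j<m. b' ! j = column t i ! j)"
      using t i by (auto simp: xe bit_vars_def column_def)
    also have "\<dots> \<longleftrightarrow> b' = column t i"
      using length_bits[OF b'] by (auto simp: list_eq_iff_nth_eq column_def)
    finally show "x \<in> {\<omega>. \<forall>k\<in>bit_vars m. rv k \<omega> = var_seqs t [] [] k ! i} \<longleftrightarrow> b' = column t i" .
  qed
qed auto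

text \<open>Typicality includes positive probability of the whole sequence, so no factor of the
  product vanishes. This makes the conditional samples of a codeword well defined.\<close>

lemma codebook_column:
  assumes t: "t \<in> codebook n \<epsilon>" and i: "i < n"
  shows "column t i \<in> set_pmf p"
proof -
  let ?U = "bit_vars m" and ?x = "var_seqs t [] []"
  have "BVar 0 \<in> ?U" using m_pos by (auto simp: bit_vars_def)
  then have "?U \<noteq> {}" by blast
  then have "seq_prob P rv ?U n ?x > 0"
    using i by (intro less_le_trans[OF _ typical_seq_prob_lower[OF codebook_typical[OF t]]]) auto
  moreover have "seq_prob P rv ?U n ?x = 0" if "pmf (joint_law P rv ?U) (\<lambda>k\<in>?U. ?x k ! i) = 0"
    unfolding seq_prob_def using i that by (intro prod_zero) auto
  ultimately have "(\<lambda>k\<in>?U. ?x k ! i) \<in> joint_rv rv ?U ` set_pmf P"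
    by (auto simp: set_pmf_iff joint_law_def simp flip: set_map_pmf)
  then obtain \<omega> where \<omega>: "\<omega> \<in> set_pmf P" and eq: "(\<lambda>k\<in>?U. ?x k ! i) = joint_rv rv ?U \<omega>"
    by (rule imageE) blast
  obtain b s y where \<omega>': "\<omega> = (b, s, y)" by (cases \<omega>)
  have "b ! j = t ! j ! i" if "j < m" for j
  proof -
    have "(\<lambda>k\<in>?U. ?x k ! i) (BVar j) = joint_rv rv ?U \<omega> (BVar j)" using eq by simp
    then show ?thesis
      using that i codebook_length[OF t] by (auto simp: joint_rv_def bit_vars_def \<omega>')
  qed
  moreover have "b \<in> set_pmf p" using set_P[OF \<omega>] \<omega>' by simp
  moreover have "column t i = b"
    using calculation length_bits by (auto simp: column_def list_eq_iff_nth_eq)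
  ultimately show ?thesis by simp
qed

lemma rv_BVar: "rv (BVar j) \<omega> = BSym (fst \<omega> ! j)"
  and rv_SVar: "rv SVar \<omega> = SSym (fst (snd \<omega>))"
  and rv_YVar: "rv YVar \<omega> = YSym (snd (snd \<omega>))"
  by (cases \<omega>; simp)+

lemma map_fst_P: "map_pmf fst P = p"
  by (simp add: source_channel_law_def map_bind_pmf bind_return_pmf')

section \<open>Probability and size of the codebook\<close>

lemma Pi_P_eq_bind:
  fixes n :: nat
  shows "Pi_pmf {..<n} undefined (\<lambda>_. P)
    = bind_pmf (Pi_pmf {..<n} d (\<lambda>_. p)) (\<lambda>b. Pi_pmf {..<n} undefined (\<lambda>i. given_bits f W (b i)))"
  unfolding source_channel_law_eq_bind by (rule Pi_pmf_bind) simp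

lemma bit_vars_nonempty: "bit_vars m \<noteq> {}"
  using m_pos by (auto simp: bit_vars_def lessThan_empty_iff)

lemma rows_in_codebook:
  assumes b: "\<And>i. i < n \<Longrightarrow> b i \<in> set_pmf p" and "\<epsilon> < 1"
    and bad: "measure_pmf.prob (Pi_pmf {..<n} undefined (\<lambda>i. given_bits f W (b i)))
      {\<omega>. samples rv n \<omega> \<notin> typical_set P rv (all_vars m) n \<epsilon>} \<le> \<epsilon>"
  shows "rows n b \<in> codebook n \<epsilon>"
proof -
  let ?R = "Pi_pmf {..<n} undefined (\<lambda>i. given_bits f W (b i))" and ?t = "rows n b"
  let ?full = "\<lambda>\<omega> k. if k \<in> bit_vars m then var_seqs ?t [] [] k else map (\<lambda>i. rv k (\<omega> i)) [0..<n]"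
  let ?typ = "typical_set P rv (all_vars m) n \<epsilon>"
  have len: "length (b i) = m" if "i < n" for i using length_bits[OF b[OF that]] .
  have t: "length ?t = m" "\<And>j. j < m \<Longrightarrow> length (?t ! j) = n" by (auto simp: rows_def)
  have col: "column ?t i = b i" if "i < n" for i using column_rows len that by blast
  have R: "cond_samples P rv (bit_vars m) n (var_seqs ?t [] []) = ?R"
    by (subst cond_samples_eq[OF t]) (use b in \<open>auto simp: col intro!: Pi_pmf_cong\<close>)
  have iff: "?full \<omega> \<in> ?typ \<longleftrightarrow> samples rv n \<omega> \<in> ?typ" if \<omega>: "\<omega> \<in> set_pmf ?R" for \<omega>
  proof (rule typical_set_cong)
    fix k assume "k \<in> all_vars m"
    have "fst (\<omega> i) = b i" if "i < n" for i
      using \<omega> that by (intro set_given_bits) (auto simp: set_Pi_pmf PiE_dflt_def)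
    then show "?full \<omega> k = samples rv n \<omega> k"
      by (auto simp: samples_def bit_vars_def rv_BVar rows_def)
  qed
  have "1 - \<epsilon> \<le> 1 - measure_pmf.prob ?R {\<omega>. samples rv n \<omega> \<notin> ?typ}" using bad by simp
  also have "\<dots> = measure_pmf.prob ?R {\<omega>. samples rv n \<omega> \<in> ?typ}"
    by (subst measure_pmf.prob_compl[symmetric]) (auto intro: arg_cong[where f = "measure_pmf.prob ?R"])
  also have "\<dots> = measure_pmf.prob ?R {\<omega>. ?full \<omega> \<in> ?typ}"
    by (rule measure_pmf.finite_measure_eq_AE) (auto simp: AE_measure_pmf_iff iff)
  finally have good: "1 - \<epsilon> \<le> measure_pmf.prob ?R {\<omega>. ?full \<omega> \<in> ?typ}" .
  \<comment> \<open>Since \<open>1 - \<epsilon>\<close> is positive, some outcome is jointly typical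
    with the bits; its restriction to the bit variables shows that the bits are typical themselves,
    the other clause of the B-typical set.\<close>
  then have "measure_pmf.prob ?R {\<omega>. ?full \<omega> \<in> ?typ} \<noteq> 0" using \<open>\<epsilon> < 1\<close> by linarith
  then obtain \<omega> where "?full \<omega> \<in> ?typ" by (auto simp: measure_pmf_zero_iff)
  then have "?full \<omega> \<in> typical_set P rv (bit_vars m) n \<epsilon>"
    by (rule typical_set_mono) (auto simp: all_vars_def)
  then have "var_seqs ?t [] [] \<in> typical_set P rv (bit_vars m) n \<epsilon>"
    by (subst typical_set_cong[of "bit_vars m" _ "?full \<omega>"]) auto
  then show ?thesis
    using good t by (simp add: codebook_def B_typical_set_def R all_vars_def)
qed

text \<open>Markov's inequality for the conditional probability \<open>r\<close> of joint
  atypicality given the bits: a mean of at most \<open>\<epsilon>\<^sup>2\<close> lets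
  \<open>r\<close> reach \<epsilon> with probability at most \<epsilon>. This is where the square in
  the hypothesis comes from.\<close>

lemma prob_rows_in_codebook:
  assumes \<epsilon>: "0 < \<epsilon>" "\<epsilon> < 1"
    and bad: "measure_pmf.prob (Pi_pmf {..<n} undefined (\<lambda>_. P))
      {\<omega>. samples rv n \<omega> \<notin> typical_set P rv (all_vars m) n \<epsilon>} \<le> \<epsilon>\<^sup>2"
  shows "1 - \<epsilon> \<le> measure_pmf.prob (Pi_pmf {..<n} d (\<lambda>_. p)) {b. rows n b \<in> codebook n \<epsilon>}"
proof -
  let ?B = "Pi_pmf {..<n} d (\<lambda>_. p)"
  define r where "r b = measure_pmf.prob (Pi_pmf {..<n} undefined (\<lambda>i. given_bits f W (b i)))
      {\<omega>. samples rv n \<omega> \<notin> typical_set P rv (all_vars m) n \<epsilon>}" for b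
  have int: "integrable (measure_pmf ?B) r"
    by (rule measure_pmf.integrable_const_bound[where B = 1]) (auto simp: r_def)
  have Er: "measure_pmf.expectation ?B r \<le> \<epsilon>\<^sup>2"
    using bad unfolding Pi_P_eq_bind[where d = d] prob_bind_pmf r_def .
  have "measure_pmf.prob ?B {b \<in> space (measure_pmf ?B). \<epsilon> \<le> r b} \<le> measure_pmf.expectation ?B r / \<epsilon>"
    by (rule integral_Markov_inequality_measure[OF int, where A = "{}"]) (use \<epsilon> in \<open>auto simp: r_def\<close>)
  also have "\<dots> \<le> \<epsilon>\<^sup>2 / \<epsilon>" using Er \<epsilon> by (intro divide_right_mono) auto
  finally have "measure_pmf.prob ?B {b. \<epsilon> \<le> r b} \<le> \<epsilon>" using \<epsilon> by (simp add: power2_eq_square)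
  then have "1 - \<epsilon> \<le> 1 - measure_pmf.prob ?B {b. \<epsilon> \<le> r b}" by simp
  also have "\<dots> = measure_pmf.prob ?B {b. r b < \<epsilon>}"
    by (subst measure_pmf.prob_compl[symmetric]) (auto intro: arg_cong[where f = "measure_pmf.prob ?B"])
  also have "\<dots> \<le> measure_pmf.prob ?B {b. rows n b \<in> codebook n \<epsilon>}"
  proof (rule measure_pmf.finite_measure_mono_AE)
    show "AE b in measure_pmf ?B. b \<in> {b. r b < \<epsilon>} \<longrightarrow> b \<in> {b. rows n b \<in> codebook n \<epsilon>}"
    proof (rule AE_pmfI, rule impI)
      fix b assume b: "b \<in> set_pmf ?B" and rb: "b \<in> {b. r b < \<epsilon>}"
      have "b i \<in> set_pmf p" if "i < n" for i
        using b that by (auto simp: set_Pi_pmf PiE_dflt_def)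
      then show "b \<in> {b. rows n b \<in> codebook n \<epsilon>}"
        using rows_in_codebook[of n b \<epsilon>] rb \<epsilon> by (simp add: r_def)
    qed
  qed simp
  finally show ?thesis .
qed

text \<open>The codebook carries probability at least \<open>1 - \<epsilon>\<close>, while a single
  typical codeword has probability at most
  \<open>2 powr (- n * (H(B) - \<epsilon>))\<close>.\<close>

lemma card_codebook_ge:
  assumes \<epsilon>: "0 < \<epsilon>" "\<epsilon> < 1" and n: "n > 0"
    and bad: "measure_pmf.prob (Pi_pmf {..<n} undefined (\<lambda>_. P))
      {\<omega>. samples rv n \<omega> \<notin> typical_set P rv (all_vars m) n \<epsilon>} \<le> \<epsilon>\<^sup>2"
  shows "(1 - \<epsilon>) * 2 powr (real n * (H (bit_vars m) - \<epsilon>)) \<le> real (card (codebook n \<epsilon>))"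
proof -
  let ?Q = "Pi_pmf {..<n} undefined (\<lambda>_. P)"
  \<comment> \<open>The default value is the image under \<open>fst\<close> of the default of
    \<open>?Q\<close>, so that \<open>?B\<close> is literally the image of
    \<open>?Q\<close>.\<close>
  let ?B = "Pi_pmf {..<n} (fst (undefined :: bool list \<times> int \<times> 'y)) (\<lambda>_. p)"
  let ?u = "2 powr (- (real n * (H (bit_vars m) - \<epsilon>)))"
  have B: "?B = map_pmf (\<lambda>\<omega>. fst \<circ> \<omega>) ?Q"
    by (subst map_fst_P[symmetric], rule Pi_pmf_map) simp_all
  have single: "measure_pmf.prob ?B {b. rows n b = t} \<le> ?u" if t: "t \<in> codebook n \<epsilon>" for t
  proof -
    have "measure_pmf.prob ?B {b. rows n b = t} = measure_pmf.prob ?Q {\<omega>. rows n (fst \<circ> \<omega>) = t}"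
      unfolding B by (simp add: vimage_def)
    also have "\<dots> \<le> measure_pmf.prob ?Q {\<omega>. \<forall>i<n. \<forall>k\<in>bit_vars m. rv k (\<omega> i) = var_seqs t [] [] k ! i}"
      by (rule measure_pmf.finite_measure_mono) (auto simp: rows_def bit_vars_def rv_BVar)
    also have "\<dots> = seq_prob P rv (bit_vars m) n (var_seqs t [] [])"
      by (rule seq_prob_eq_measure[symmetric])
    also have "\<dots> \<le> ?u"
      by (rule typical_seq_prob_upper[OF codebook_typical[OF t] order_refl bit_vars_nonempty n])
    finally show ?thesis .
  qed
  have "1 - \<epsilon> \<le> measure_pmf.prob ?B {b. rows n b \<in> codebook n \<epsilon>}"
    by (rule prob_rows_in_codebook[OF \<epsilon> bad])
  also have "{b. rows n b \<in> codebook n \<epsilon>} = (\<Union>t\<in>codebook n \<epsilon>. {b. rows n b = t})" by auto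
  also have "measure_pmf.prob ?B \<dots> \<le> (\<Sum>t\<in>codebook n \<epsilon>. measure_pmf.prob ?B {b. rows n b = t})"
    by (rule measure_pmf.finite_measure_subadditive_finite) (auto simp: finite_codebook)
  also have "\<dots> \<le> (\<Sum>t\<in>codebook n \<epsilon>. ?u)" by (intro sum_mono single)
  finally have "1 - \<epsilon> \<le> real (card (codebook n \<epsilon>)) * ?u" by simp
  then have "(1 - \<epsilon>) * 2 powr (real n * (H (bit_vars m) - \<epsilon>))
      \<le> real (card (codebook n \<epsilon>)) * ?u * 2 powr (real n * (H (bit_vars m) - \<epsilon>))"
    by (rule mult_right_mono) simp
  then show ?thesis by (simp add: mult.assoc flip: powr_add)
qed

section \<open>Failed and accidental matches, before any encoder is chosen\<close>

definition matches :: "nat \<Rightarrow> real \<Rightarrow> bool list list \<Rightarrow> int list \<Rightarrow> 'y list \<Rightarrow> bool" where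
  "matches n \<epsilon> t s y \<longleftrightarrow> var_seqs t s y \<in> typical_set P rv {SVar, YVar} n \<epsilon> \<and>
     (\<forall>j<m. var_seqs t s y \<in> typical_set P rv {BVar j, YVar} n \<epsilon>)"

definition output_law :: "nat \<Rightarrow> bool list list \<Rightarrow> int list \<Rightarrow> 'y list pmf" where
  "output_law n t s = memoryless W (map (\<lambda>i. s ! i * f (column t i)) [0..<n])"

text \<open>Joint typicality of all variables implies every test of the decoder, as each test
  concerns a subcollection. The bound holds for the sum over all signs and not for each sign
  sequence; \<open>2 ^ n\<close> is the number of sign sequences.\<close>

lemma sum_prob_no_match:
  assumes t: "t \<in> codebook n \<epsilon>"
  shows "(\<Sum>s\<in>sign_seqs n. measure_pmf.prob (output_law n t s) {y. \<not> matches n \<epsilon> t s y}) \<le> \<epsilon> * 2 ^ n"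
proof -
  let ?R = "Pi_pmf {..<n} undefined (\<lambda>i. given_bits f W (column t i))"
  let ?full = "\<lambda>\<omega> k. if k \<in> bit_vars m then var_seqs t [] [] k else map (\<lambda>i. rv k (\<omega> i)) [0..<n]"
  let ?typ = "typical_set P rv (bit_vars m \<union> {SVar, YVar}) n \<epsilon>"
  let ?g = "\<lambda>\<omega>. (map (\<lambda>i. fst (snd (\<omega> i))) [0..<n], map (\<lambda>i. snd (snd (\<omega> i))) [0..<n])"
  define M where "M = {(s, y). matches n \<epsilon> t s y}"
  have R: "cond_samples P rv (bit_vars m) n (var_seqs t [] []) = ?R"
    by (rule cond_samples_eq) (use codebook_length[OF t] codebook_column[OF t] in auto)
  have "1 - \<epsilon> \<le> measure_pmf.prob ?R {\<omega>. ?full \<omega> \<in> ?typ}"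
    using t by (simp add: codebook_def B_typical_set_def R)
  also have "\<dots> \<le> measure_pmf.prob ?R {\<omega>. ?g \<omega> \<in> M}"
  proof (rule measure_pmf.finite_measure_mono)
    show "{\<omega>. ?full \<omega> \<in> ?typ} \<subseteq> {\<omega>. ?g \<omega> \<in> M}"
    proof (intro subsetI CollectI)
      fix \<omega> assume "\<omega> \<in> {\<omega>. ?full \<omega> \<in> ?typ}"
      then have \<omega>: "?full \<omega> \<in> ?typ" by simp
      obtain s y where g: "?g \<omega> = (s, y)" by blast
      have "var_seqs t s y \<in> typical_set P rv J n \<epsilon>" if J: "J \<subseteq> bit_vars m \<union> {SVar, YVar}" for J
      proof -
        have eq: "var_seqs t s y k = ?full \<omega> k" if "k \<in> J" for k
          using that J g by (auto simp: bit_vars_def rv_SVar rv_YVar)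
        then show ?thesis
          by (subst typical_set_cong[OF eq]) (auto intro: typical_set_mono[OF \<omega> J])
      qed
      then have "matches n \<epsilon> t s y" unfolding matches_def by (simp add: bit_vars_def)
      then show "?g \<omega> \<in> M" by (simp add: M_def g)
    qed
  qed simp
  also have "\<dots> = measure_pmf.prob (map_pmf ?g ?R) M" by (simp add: vimage_def)
  finally have "measure_pmf.prob (map_pmf ?g ?R) (- M) \<le> \<epsilon>"
    using measure_pmf.prob_compl[of M "map_pmf ?g ?R"] by (simp add: Compl_eq_Diff_UNIV)
  moreover have "map_pmf ?g ?R = bind_pmf (pmf_of_set (sign_seqs n)) (\<lambda>s. map_pmf (Pair s) (output_law n t s))"
    unfolding Pi_given_bits output_law_def by (simp add: map_pmf_def)
  ultimately have "measure_pmf.expectation (pmf_of_set (sign_seqs n))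
      (\<lambda>s. measure_pmf.prob (map_pmf (Pair s) (output_law n t s)) (- M)) \<le> \<epsilon>"
    by (simp only: prob_bind_pmf)
  then have "(\<Sum>s\<in>sign_seqs n. measure_pmf.prob (map_pmf (Pair s) (output_law n t s)) (- M)) / 2 ^ n \<le> \<epsilon>"
    by (subst (asm) integral_pmf_of_set) (simp_all add: sign_seqs_nonempty finite_sign_seqs card_sign_seqs)
  then show ?thesis
    by (simp add: field_simps M_def vimage_def)
qed

lemma card_typical_signs_le:
  assumes "n > 0"
  shows "real (card {s \<in> sign_seqs n. var_seqs t s y \<in> typical_set P rv {SVar, YVar} n \<epsilon>})
    \<le> 2 powr (real n * (H {SVar, YVar} - H {YVar} + 2 * \<epsilon>))"
proof (rule card_typical_extensions_le[where x = "\<lambda>s. var_seqs t s y" and y = "var_seqs t [] y"])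
  fix a b assume ab: "a \<in> {s \<in> sign_seqs n. var_seqs t s y \<in> typical_set P rv {SVar, YVar} n \<epsilon>}"
      "b \<in> {s \<in> sign_seqs n. var_seqs t s y \<in> typical_set P rv {SVar, YVar} n \<epsilon>}"
    and eq: "\<And>k i. k \<in> {SVar, YVar} \<Longrightarrow> i < n \<Longrightarrow> var_seqs t a y k ! i = var_seqs t b y k ! i"
  have "length a = n" "length b = n" using ab by (auto simp: sign_seqs_def)
  then show "a = b" using eq[of SVar] by (auto simp: list_eq_iff_nth_eq)
qed (use assms finite_sign_seqs in auto)

text \<open>
  The list \<open>replicate (Suc j) l\<close> is only a way of putting \<open>l\<close> at position \<open>j\<close>.
\<close>

lemma card_typical_bits_le:
  assumes "n > 0"
  shows "real (card {l. length l = n \<and> var_seqs (replicate (Suc j) l) [] y \<in> typical_set P rv {BVar j, YVar} n \<epsilon>})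
    \<le> 2 powr (real n * (H {BVar j, YVar} - H {YVar} + 2 * \<epsilon>))"
proof (rule card_typical_extensions_le[where x = "\<lambda>l. var_seqs (replicate (Suc j) l) [] y" and y = "var_seqs [] [] y"])
  fix a b :: "bool list"
  let ?A = "{l. length l = n \<and> var_seqs (replicate (Suc j) l) [] y \<in> typical_set P rv {BVar j, YVar} n \<epsilon>}"
  assume ab: "a \<in> ?A" "b \<in> ?A"
    and eq: "\<And>k i. k \<in> {BVar j, YVar} \<Longrightarrow> i < n \<Longrightarrow>
      var_seqs (replicate (Suc j) a) [] y k ! i = var_seqs (replicate (Suc j) b) [] y k ! i"
  have "length a = n" "length b = n" using ab by auto
  then show "a = b" using eq[of "BVar j"] by (auto simp: list_eq_iff_nth_eq simp del: replicate_Suc)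
next
  show "finite {l. length l = n \<and> var_seqs (replicate (Suc j) l) [] y \<in> typical_set P rv {BVar j, YVar} n \<epsilon>}"
    by (rule finite_subset[OF _ finite_lists_length_eq[of UNIV n]]) auto
qed (use assms in auto)

text \<open>The sum of \<open>H(S|Y)\<close> and all \<open>H(B_j|Y)\<close>, written with joint
  entropies because the counting of typical extensions yields such differences.\<close>

definition equivocation :: real where
  "equivocation = H {SVar, YVar} - H {YVar} + (\<Sum>j<m. H {BVar j, YVar} - H {YVar})"

text \<open>For a fixed output the tests on the \<open>m\<close> rows and on the sign sequence are
  independent of each other, so the matching pairs inject into a product of \<open>m + 1\<close>
  sets of typical extensions of \<open>y\<close>. Each factor contributes a slack of
  \<open>2 * \<epsilon>\<close>.\<close>

lemma card_matches_le:
  assumes n: "n > 0"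
  shows "real (card {(t, s) \<in> codebook n \<epsilon> \<times> sign_seqs n. matches n \<epsilon> t s y})
    \<le> 2 powr (real n * (equivocation + 2 * (real m + 1) * \<epsilon>))"
proof -
  define A where "A j = {l. length l = n \<and>
      var_seqs (replicate (Suc j) l) [] y \<in> typical_set P rv {BVar j, YVar} n \<epsilon>}" for j
  define S where "S = {s \<in> sign_seqs n. var_seqs [] s y \<in> typical_set P rv {SVar, YVar} n \<epsilon>}"
  let ?M = "{(t, s) \<in> codebook n \<epsilon> \<times> sign_seqs n. matches n \<epsilon> t s y}"
  have finA: "finite (A j)" for j
    unfolding A_def by (rule finite_subset[OF _ finite_lists_length_eq[of UNIV n]]) auto
  let ?h = "\<lambda>(t, s). (restrict ((!) t) {..<m}, s)"
  have "card ?M \<le> card (PiE {..<m} A \<times> S)"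
  proof (rule card_inj_on_le[of ?h])
    show "inj_on ?h ?M"
    proof (rule inj_onI, clarify)
      fix t s t' s' assume t: "t \<in> codebook n \<epsilon>" "t' \<in> codebook n \<epsilon>"
        and eq: "restrict ((!) t) {..<m} = restrict ((!) t') {..<m}"
      have "t ! j = t' ! j" if "j < m" for j
        using fun_cong[OF eq, of j] that by simp
      then show "t = t' \<and> s' = s'"
        using codebook_length(1)[OF t(1)] codebook_length(1)[OF t(2)] by (auto intro: nth_equalityI)
    qed
    show "?h ` ?M \<subseteq> PiE {..<m} A \<times> S"
    proof (rule image_subsetI, clarify, rule conjI)
      fix t s assume t: "t \<in> codebook n \<epsilon>" and s: "s \<in> sign_seqs n" and M: "matches n \<epsilon> t s y"
      show "restrict ((!) t) {..<m} \<in> PiE {..<m} A"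
      proof (rule restrict_PiE_iff[THEN iffD2], rule ballI)
        fix j assume "j \<in> {..<m}"
        then have j: "j < m" by simp
        have "var_seqs t s y \<in> typical_set P rv {BVar j, YVar} n \<epsilon>"
          using M j by (simp add: matches_def)
        then have "var_seqs (replicate (Suc j) (t ! j)) [] y \<in> typical_set P rv {BVar j, YVar} n \<epsilon>"
          by (subst typical_set_cong[of _ _ "var_seqs t s y"]) (auto simp del: replicate_Suc)
        then show "t ! j \<in> A j" using codebook_length(2)[OF t j] by (simp add: A_def)
      qed
      have "var_seqs t s y \<in> typical_set P rv {SVar, YVar} n \<epsilon>"
        using M by (simp add: matches_def)
      then have "var_seqs [] s y \<in> typical_set P rv {SVar, YVar} n \<epsilon>"
        by (subst typical_set_cong[of _ _ "var_seqs t s y"]) auto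
      then show "s \<in> S" using s by (simp add: S_def)
    qed
    show "finite (PiE {..<m} A \<times> S)"
      using finA finite_sign_seqs by (auto intro!: finite_cartesian_product finite_PiE simp: S_def)
  qed
  then have "real (card ?M) \<le> (\<Prod>j<m. real (card (A j))) * real (card S)"
    by (simp add: card_cartesian_product card_PiE flip: of_nat_prod of_nat_mult)
  also have "\<dots> \<le> (\<Prod>j<m. 2 powr (real n * (H {BVar j, YVar} - H {YVar} + 2 * \<epsilon>)))
      * 2 powr (real n * (H {SVar, YVar} - H {YVar} + 2 * \<epsilon>))"
    unfolding A_def S_def
    by (intro mult_mono prod_mono conjI card_typical_bits_le card_typical_signs_le n prod_nonneg) auto
  also have "\<dots> = 2 powr ((\<Sum>j<m. real n * (H {BVar j, YVar} - H {YVar} + 2 * \<epsilon>))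
      + real n * (H {SVar, YVar} - H {YVar} + 2 * \<epsilon>))"
    by (simp add: powr_sum powr_add)
  also have "(\<Sum>j<m. real n * (H {BVar j, YVar} - H {YVar} + 2 * \<epsilon>))
      + real n * (H {SVar, YVar} - H {YVar} + 2 * \<epsilon>) = real n * (equivocation + 2 * (real m + 1) * \<epsilon>)"
    by (simp add: equivocation_def sum.distrib sum_subtractf sum_distrib_left algebra_simps)
  finally show ?thesis .
qed

text \<open>The count of matching pairs is bounded at every output, so its mean is bounded under any
  output law, in particular whatever is sent.\<close>

lemma sum_prob_match_le:
  assumes "n > 0"
  shows "(\<Sum>t'\<in>codebook n \<epsilon>. \<Sum>s'\<in>sign_seqs n. measure_pmf.prob (output_law n t s) {y. matches n \<epsilon> t' s' y})
    \<le> 2 powr (real n * (equivocation + 2 * (real m + 1) * \<epsilon>))"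
proof -
  have "(\<Sum>a\<in>codebook n \<epsilon> \<times> sign_seqs n.
        measure_pmf.prob (output_law n t s) {y. matches n \<epsilon> (fst a) (snd a) y})
    \<le> 2 powr (real n * (equivocation + 2 * (real m + 1) * \<epsilon>))"
  proof (rule sum_prob_le_card)
    fix y
    have "{a \<in> codebook n \<epsilon> \<times> sign_seqs n. matches n \<epsilon> (fst a) (snd a) y}
        = {(t, s) \<in> codebook n \<epsilon> \<times> sign_seqs n. matches n \<epsilon> t s y}" by auto
    then show "real (card {a \<in> codebook n \<epsilon> \<times> sign_seqs n. matches n \<epsilon> (fst a) (snd a) y})
        \<le> 2 powr (real n * (equivocation + 2 * (real m + 1) * \<epsilon>))"
      using card_matches_le[OF assms] by simp
  qed (simp add: finite_codebook finite_sign_seqs)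
  then show ?thesis by (simp add: sum.cartesian_product')
qed

end

section \<open>Achievability\<close>

text \<open>Decoding succeeds whenever the sent pair matches and no other pair does; the rest is a
  union bound over the competitors and the average over uniform messages.\<close>

lemma error_prob_le:
  fixes m n :: nat and E :: sign_coding and f :: "bool list \<Rightarrow> int"
    and W :: "int \<Rightarrow> 'y::countable pmf"
  assumes "num_amp E \<ge> 1"
  defines "I \<equiv> {1..num_amp E} \<times> {1..num_sign E n}"
    and "L \<equiv> \<lambda>c. memoryless W (codeword m f n E (fst c) (snd c))"
    and "R \<equiv> \<lambda>y c. bmd_match m f W n E y (fst c) (snd c)"
  shows "error_prob m f W n E
    \<le> ((\<Sum>c\<in>I. measure_pmf.prob (L c) {y. \<not> R y c})
       + (\<Sum>c\<in>I. \<Sum>c'\<in>I - {c}. measure_pmf.prob (L c) {y. R y c'}))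
      / (real (num_amp E) * real (num_sign E n))"
proof -
  let ?A = "{1..num_amp E}" and ?S = "{1..num_sign E n}"
  define err where "err = {(c, y). bmd_decode m f W n E y \<noteq> Some c}"
  have I: "finite I" by (simp add: I_def)
  have S: "?S \<noteq> {}" by (simp add: num_sign_def)
  have "transmission m f W n E
      = bind_pmf (pmf_of_set ?A) (\<lambda>a. bind_pmf (pmf_of_set ?S) (\<lambda>s. map_pmf (Pair (a, s)) (L (a, s))))"
    unfolding transmission_def L_def by (simp add: map_pmf_def)
  then have "error_prob m f W n E = (\<Sum>a\<in>?A. (\<Sum>s\<in>?S. measure_pmf.prob (map_pmf (Pair (a, s)) (L (a, s))) err)
      / real (num_sign E n)) / real (num_amp E)"
    unfolding error_prob_def err_def[symmetric] using assms(1) S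
    by (simp add: prob_bind_pmf integral_pmf_of_set sum_divide_distrib mult.commute)
  also have "\<dots> = (\<Sum>c\<in>I. measure_pmf.prob (map_pmf (Pair c) (L c)) err) / (real (num_amp E) * real (num_sign E n))"
    by (simp add: I_def sum.cartesian_product' sum_divide_distrib mult.commute)
  also have "(\<Sum>c\<in>I. measure_pmf.prob (map_pmf (Pair c) (L c)) err)
      \<le> (\<Sum>c\<in>I. measure_pmf.prob (L c) {y. \<not> R y c}
          + (\<Sum>c'\<in>I - {c}. measure_pmf.prob (L c) {y. R y c'}))"
  proof (rule sum_mono)
    fix c assume c: "c \<in> I"
    have dec: "bmd_decode m f W n E y = Some c" if "R y c" "\<And>c'. c' \<in> I - {c} \<Longrightarrow> \<not> R y c'" for y
    proof -
      have "{(a, s). a \<in> ?A \<and> s \<in> ?S \<and> bmd_match m f W n E y a s} = {c}"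
        using c that unfolding I_def R_def by fastforce
      then show ?thesis unfolding bmd_decode_def by simp
    qed
    have "measure_pmf.prob (map_pmf (Pair c) (L c)) err = measure_pmf.prob (L c) {y. bmd_decode m f W n E y \<noteq> Some c}"
      by (simp add: vimage_def err_def)
    also have "\<dots> \<le> measure_pmf.prob (L c) ({y. \<not> R y c} \<union> (\<Union>c'\<in>I - {c}. {y. R y c'}))"
      using dec by (intro measure_pmf.finite_measure_mono) auto
    also have "\<dots> \<le> measure_pmf.prob (L c) {y. \<not> R y c} + measure_pmf.prob (L c) (\<Union>c'\<in>I - {c}. {y. R y c'})"
      by (rule measure_Un_le) auto
    also have "measure_pmf.prob (L c) (\<Union>c'\<in>I - {c}. {y. R y c'}) \<le> (\<Sum>c'\<in>I - {c}. measure_pmf.prob (L c) {y. R y c'})"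
      using I by (intro measure_pmf.finite_measure_subadditive_finite) auto
    finally show "measure_pmf.prob (map_pmf (Pair c) (L c)) err
        \<le> measure_pmf.prob (L c) {y. \<not> R y c} + (\<Sum>c'\<in>I - {c}. measure_pmf.prob (L c) {y. R y c'})"
      by simp
  qed
  finally show ?thesis
    by (simp add: sum.distrib divide_right_mono)
qed

lemma sum_append_sign_seqs:
  "(\<Sum>\<sigma>\<in>sign_seqs k \<times> sign_seqs l. F (fst \<sigma> @ snd \<sigma>)) = (\<Sum>s\<in>sign_seqs (k + l). F s)"
  using sum.reindex_bij_betw[OF bij_betw_append_sign_seqs[of k l], of F] by (simp add: case_prod_unfold)

context bit_channel
begin

text \<open>The second sign parts are chosen as a function \<open>g\<close> of codewords and first
  sign parts; messages enter only through the numberings \<open>e\<close> and \<open>h\<close>,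
  along which the sums in the error bound are reindexed.\<close>

lemma ex_encoder:
  assumes n: "n > 0" and \<epsilon>: "0 < \<epsilon>" and ne: "codebook n \<epsilon> \<noteq> {}"
    and \<gamma>: "0 < \<gamma>" "\<gamma> < 1" and n1: "n1 = nat \<lfloor>\<gamma> * real n\<rfloor>" "n1 > 0"
  shows "\<exists>E. modified_sign_coding m f W n E \<and> num_amp E = card (codebook n \<epsilon>) \<and> num_sign E n = 2 ^ n1 \<and>
    error_prob m f W n E \<le> \<epsilon> + 2 powr (real n * (equivocation + 2 * (real m + 1) * \<epsilon>)) / 2 ^ (n - n1)"
proof -
  let ?T = "codebook n \<epsilon>" and ?S1 = "sign_seqs n1" and ?S2 = "sign_seqs (n - n1)"
  define \<beta> where "\<beta> = 2 powr (real n * (equivocation + 2 * (real m + 1) * \<epsilon>))"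
  have "\<gamma> * real n \<le> real n" using \<gamma> by (simp add: mult_left_le_one_le)
  then have "n1 \<le> n" unfolding n1(1) by linarith
  then have n_eq: "n1 + (n - n1) = n" by simp
  define q where "q t \<sigma> = measure_pmf.prob (output_law n t (fst \<sigma> @ snd \<sigma>)) {y. \<not> matches n \<epsilon> t (fst \<sigma> @ snd \<sigma>) y}"
    for t and \<sigma> :: "int list \<times> int list"
  define v where "v t \<sigma> t' \<sigma>' = measure_pmf.prob (output_law n t (fst \<sigma> @ snd \<sigma>)) {y. matches n \<epsilon> t' (fst \<sigma>' @ snd \<sigma>') y}"
    for t t' and \<sigma> \<sigma>' :: "int list \<times> int list"
  have "\<exists>g\<in>?T \<times> ?S1 \<rightarrow> ?S2.
           (\<Sum>(b, s)\<in>?T \<times> ?S1. q b (s, g (b, s)))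
           + (\<Sum>(b, s)\<in>?T \<times> ?S1. \<Sum>(b', s')\<in>?T \<times> ?S1 - {(b, s)}. v b (s, g (b, s)) b' (s', g (b', s')))
           \<le> (real (card ?T) * real (card ?S1)) * (\<epsilon> + \<beta> / real (card ?S2))"
  proof (rule ex_good_code)
    show "(\<Sum>\<sigma>\<in>?S1 \<times> ?S2. q t \<sigma>) \<le> \<epsilon> * (real (card ?S1) * real (card ?S2))" if "t \<in> ?T" for t
    proof -
      have "(\<Sum>\<sigma>\<in>?S1 \<times> ?S2. q t \<sigma>) \<le> \<epsilon> * 2 ^ n"
        using sum_prob_no_match[OF that] unfolding q_def
        by (simp only: sum_append_sign_seqs[where F = "\<lambda>s. measure_pmf.prob (output_law n t s) {y. \<not> matches n \<epsilon> t s y}"] n_eq)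
      also have "(2 :: real) ^ n = real (card ?S1) * real (card ?S2)"
        by (simp add: card_sign_seqs n_eq flip: power_add)
      finally show ?thesis .
    qed
    show "(\<Sum>t'\<in>?T. \<Sum>\<sigma>'\<in>?S1 \<times> ?S2. v t \<sigma> t' \<sigma>') \<le> \<beta>" for t \<sigma>
      using sum_prob_match_le[OF n, where \<epsilon> = \<epsilon> and t = t and s = "fst \<sigma> @ snd \<sigma>"] unfolding v_def \<beta>_def
      by (simp only: sum_append_sign_seqs[where F = "\<lambda>s'. measure_pmf.prob (output_law n t (fst \<sigma> @ snd \<sigma>)) {y. matches n \<epsilon> t' s' y}" for t'] n_eq)
  qed (auto simp: finite_codebook finite_sign_seqs sign_seqs_nonempty v_def)
  then obtain g where g: "g \<in> ?T \<times> ?S1 \<rightarrow> ?S2"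
    and le: "(\<Sum>c\<in>?T \<times> ?S1. q (fst c) (snd c, g c))
      + (\<Sum>c\<in>?T \<times> ?S1. \<Sum>c'\<in>?T \<times> ?S1 - {c}. v (fst c) (snd c, g c) (fst c') (snd c', g c'))
      \<le> (real (card ?T) * real (card ?S1)) * (\<epsilon> + \<beta> / real (card ?S2))"
    by (auto simp: case_prod_unfold)
  obtain e where e: "bij_betw e {1..card ?T} ?T"
    using ex_bij_betw_nat_finite_1[OF finite_codebook] by blast
  obtain h where h: "bij_betw h {1..(2 :: nat) ^ n1} ?S1"
    using ex_bij_betw_nat_finite_1[OF finite_sign_seqs] by (auto simp: card_sign_seqs)
  \<comment> \<open>Composing \<open>g\<close> with the numberings makes the second part a function
    of the amplitude codeword and the first sign part.\<close>
  define E where "E = \<lparr>bit_law = p, sign_frac = \<gamma>, tol = \<epsilon>, num_amp = card ?T, shaping = e, sign1 = h,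
    sign2 = \<lambda>a s. g (e a, h s)\<rparr>"
  have nis: "num_info_signs E n = n1" by (simp add: num_info_signs_def E_def n1)
  have num: "num_amp E = card ?T" "num_sign E n = 2 ^ n1" by (simp_all add: E_def num_sign_def nis[unfolded E_def])
  have cardT: "card ?T \<ge> 1" using ne finite_codebook by (simp add: Suc_le_eq card_gt_0_iff)
  have eT: "e a \<in> ?T" if "a \<in> {1..card ?T}" for a using e that by (rule bij_betwE[rule_format])
  have hS: "h s \<in> ?S1" if "s \<in> {1..(2 :: nat) ^ n1}" for s using h that by (rule bij_betwE[rule_format])
  have E: "modified_sign_coding m f W n E"
    unfolding modified_sign_coding_def nis num
    using bits \<gamma> \<epsilon> n1 cardT e h eT hS g
    by (auto simp: E_def bij_betw_def codebook_def Pi_iff)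
  define \<phi> where "\<phi> = map_prod e h"
  let ?I = "{1..num_amp E} \<times> {1..num_sign E n}"
  have \<phi>: "bij_betw \<phi> ?I (?T \<times> ?S1)"
    unfolding \<phi>_def num by (rule bij_betw_map_prod[OF e h])
  have \<phi>_diff: "bij_betw \<phi> (?I - {c}) (?T \<times> ?S1 - {\<phi> c})" if "c \<in> ?I" for c
    using that \<phi> by (intro bij_betw_DiffI) (auto simp: bij_betw_def)
  have match: "bmd_match m f W n E y (fst c) (snd c)
      \<longleftrightarrow> matches n \<epsilon> (fst (\<phi> c)) (snd (\<phi> c) @ g (\<phi> c)) y" for c y
    by (cases c) (simp add: bmd_match_def matches_def E_def sign_seq_def \<phi>_def Let_def)
  have word: "memoryless W (codeword m f n E (fst c) (snd c))
      = output_law n (fst (\<phi> c)) (snd (\<phi> c) @ g (\<phi> c))" if "c \<in> ?I" for c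
  proof -
    have \<phi>c: "\<phi> c \<in> ?T \<times> ?S1" using \<phi> that by (rule bij_betwE[rule_format])
    have "g (\<phi> c) \<in> ?S2" by (rule funcset_mem[OF g \<phi>c])
    then have len: "length (snd (\<phi> c) @ g (\<phi> c)) = n"
      using \<phi>c n_eq by (auto simp: sign_seqs_def)
    have "codeword m f n E (fst c) (snd c)
        = map (\<lambda>i. (snd (\<phi> c) @ g (\<phi> c)) ! i * f (column (fst (\<phi> c)) i)) [0..<n]"
      using len by (cases c) (auto intro!: nth_equalityI
          simp: codeword_def amp_seq_def sign_seq_def E_def \<phi>_def column_def mult.commute)
    then show ?thesis by (simp add: output_law_def)
  qed
  have "error_prob m f W n E
    \<le> ((\<Sum>c\<in>?I. q (fst (\<phi> c)) (snd (\<phi> c), g (\<phi> c)))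
       + (\<Sum>c\<in>?I. \<Sum>c'\<in>?I - {c}. v (fst (\<phi> c)) (snd (\<phi> c), g (\<phi> c)) (fst (\<phi> c')) (snd (\<phi> c'), g (\<phi> c'))))
      / (real (num_amp E) * real (num_sign E n))"
    using error_prob_le[of E m f W n] cardT by (simp add: num word match q_def v_def cong: sum.cong_simp)
  also have "(\<Sum>c\<in>?I. q (fst (\<phi> c)) (snd (\<phi> c), g (\<phi> c))) = (\<Sum>c\<in>?T \<times> ?S1. q (fst c) (snd c, g c))"
    by (rule sum.reindex_bij_betw[OF \<phi>])
  also have "(\<Sum>c\<in>?I. \<Sum>c'\<in>?I - {c}. v (fst (\<phi> c)) (snd (\<phi> c), g (\<phi> c)) (fst (\<phi> c')) (snd (\<phi> c'), g (\<phi> c')))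
      = (\<Sum>c\<in>?I. \<Sum>c'\<in>?T \<times> ?S1 - {\<phi> c}. v (fst (\<phi> c)) (snd (\<phi> c), g (\<phi> c)) (fst c') (snd c', g c'))"
    by (intro sum.cong refl sum.reindex_bij_betw[OF \<phi>_diff])
  also have "\<dots> = (\<Sum>c\<in>?T \<times> ?S1. \<Sum>c'\<in>?T \<times> ?S1 - {c}. v (fst c) (snd c, g c) (fst c') (snd c', g c'))"
    by (rule sum.reindex_bij_betw[OF \<phi>])
  also have "((\<Sum>c\<in>?T \<times> ?S1. q (fst c) (snd c, g c))
      + (\<Sum>c\<in>?T \<times> ?S1. \<Sum>c'\<in>?T \<times> ?S1 - {c}. v (fst c) (snd c, g c) (fst c') (snd c', g c')))
      / (real (num_amp E) * real (num_sign E n))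
    \<le> ((real (card ?T) * real (card ?S1)) * (\<epsilon> + \<beta> / real (card ?S2)))
      / (real (num_amp E) * real (num_sign E n))"
    by (rule divide_right_mono[OF le]) simp
  also have "\<dots> = \<epsilon> + \<beta> / 2 ^ (n - n1)"
    using cardT by (simp add: num card_sign_seqs)
  finally show ?thesis
    using E num unfolding \<beta>_def by blast
qed

section \<open>Entropy identities and the choice of parameters\<close>

lemma bits_signs_law:
  "map_pmf (\<lambda>\<omega>. (fst \<omega>, fst (snd \<omega>))) P = pair_pmf p (pmf_of_set signs)"
  by (simp add: source_channel_law_def pair_pmf_def map_bind_pmf bind_return_pmf')

text \<open>The sign is uniform on two values and independent of the bits, so including it halves
  every probability and adds one bit of information at each sample of the support.\<close>

lemma joint_entropy_insert_sign: "H (insert SVar (bit_vars m)) = 1 + H (bit_vars m)"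
proof -
  let ?U = "bit_vars m"
  have U: "?U \<subseteq> all_vars m" "insert SVar ?U \<subseteq> all_vars m" by (auto simp: all_vars_def)
  have fe: "finite_joint_entropy P rv ?U" "finite_joint_entropy P rv (insert SVar ?U)"
    using finite_entropy[OF U(1)] finite_entropy[OF U(2)] bit_vars_nonempty by auto
  have "info P rv (insert SVar ?U) \<omega> = 1 + info P rv ?U \<omega>" if \<omega>: "\<omega> \<in> set_pmf P" for \<omega>
  proof -
    define B where "B = {b. \<forall>j<m. b ! j = fst \<omega> ! j}"
    have s: "fst (snd \<omega>) \<in> signs" using \<omega> by (auto simp: source_channel_law_def)
    have "pmf (joint_law P rv (insert SVar ?U)) (joint_rv rv (insert SVar ?U) \<omega>)
        = measure_pmf.prob (map_pmf (\<lambda>\<omega>. (fst \<omega>, fst (snd \<omega>))) P) (B \<times> {fst (snd \<omega>)})"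
      unfolding pmf_joint_law
      by (auto simp: B_def bit_vars_def rv_BVar rv_SVar vimage_def intro!: arg_cong[where f = "measure_pmf.prob P"])
    also have "\<dots> = measure_pmf.prob p B * measure_pmf.prob (pmf_of_set signs) {fst (snd \<omega>)}"
      unfolding bits_signs_law by (rule measure_pmf_prob_product) auto
    also have "measure_pmf.prob (pmf_of_set signs) {fst (snd \<omega>)} = 1 / 2"
      using s by (simp add: measure_pmf_single card_signs)
    also have "measure_pmf.prob p B = measure_pmf.prob (map_pmf fst P) B"
      by (simp only: map_fst_P)
    also have "\<dots> = pmf (joint_law P rv ?U) (joint_rv rv ?U \<omega>)"
      unfolding pmf_joint_law
      by (auto simp: B_def bit_vars_def rv_BVar vimage_def intro!: arg_cong[where f = "measure_pmf.prob P"])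
    finally have "pmf (joint_law P rv (insert SVar ?U)) (joint_rv rv (insert SVar ?U) \<omega>)
        = pmf (joint_law P rv ?U) (joint_rv rv ?U \<omega>) / 2" by simp
    then show ?thesis
      unfolding info_def using pmf_joint_law_pos[OF \<omega>, of rv ?U] by (simp only: log_divide) simp
  qed
  then have "measure_pmf.expectation P (info P rv (insert SVar ?U))
      = measure_pmf.expectation P (\<lambda>\<omega>. 1 + info P rv ?U \<omega>)"
    by (intro integral_cong_AE) (auto simp: AE_measure_pmf_iff)
  also have "\<dots> = 1 + measure_pmf.expectation P (info P rv ?U)"
    using integrable_info[OF fe(1)] by simp
  finally show ?thesis
    by (simp add: joint_entropy_eq_info fe)
qed

lemma R_BMD_eq: "R_BMD m f W p = 1 + H (bit_vars m) - equivocation"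
proof -
  have "finite_joint_entropy P rv {SVar, YVar}" "finite_joint_entropy P rv {YVar}"
    by (rule finite_entropy; simp add: all_vars_def)+
  moreover have "finite_joint_entropy P rv {BVar j, YVar}" if "j < m" for j
    by (rule finite_entropy) (use that in \<open>auto simp: all_vars_def bit_vars_def\<close>)
  ultimately show ?thesis
    by (simp add: R_BMD_def Let_def cond_entropy_eq_joint_entropy joint_entropy_insert_sign equivocation_def
        cong: sum.cong_simp)
qed

lemma eventually_typical:
  assumes "\<epsilon> > 0"
  shows "\<forall>\<^sub>F n in sequentially. measure_pmf.prob (Pi_pmf {..<n} undefined (\<lambda>_. P))
      {\<omega>. samples rv n \<omega> \<notin> typical_set P rv (all_vars m) n \<epsilon>} \<le> \<epsilon>\<^sup>2"
proof -
  have "finite (all_vars m)" by (simp add: all_vars_def bit_vars_def)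
  then have "\<forall>\<^sub>F n in sequentially. measure_pmf.prob (Pi_pmf {..<n} undefined (\<lambda>_. P))
      {\<omega>. samples rv n \<omega> \<notin> typical_set P rv (all_vars m) n \<epsilon>} < \<epsilon>\<^sup>2"
    using assms by (intro order_tendstoD(2)[OF prob_not_typical_tendsto] finite_entropy) auto
  then show ?thesis by eventually_elim simp
qed

text \<open>A crude bound that serves to make the supremum finite. It compares the lower bound on
  the codebook at tolerance \<open>1/2\<close> with the number \<open>(2 ^ n) ^ m\<close> of all
  tuples, for one suitable \<open>n\<close>.\<close>

lemma bits_entropy_le: "bits_entropy m f W p \<le> real m + 2"
proof -
  let ?h = "H (bit_vars m)"
  have "\<forall>\<^sub>F n in sequentially. n > 0 \<and> measure_pmf.prob (Pi_pmf {..<n} undefined (\<lambda>_. P))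
      {\<omega>. samples rv n \<omega> \<notin> typical_set P rv (all_vars m) n (1/2)} \<le> (1/2)\<^sup>2"
    using eventually_typical[OF half_gt_zero[OF zero_less_one]] eventually_gt_at_top[of 0]
    by eventually_elim auto
  then obtain n where n: "n > 0" and "measure_pmf.prob (Pi_pmf {..<n} undefined (\<lambda>_. P))
      {\<omega>. samples rv n \<omega> \<notin> typical_set P rv (all_vars m) n (1/2)} \<le> (1/2)\<^sup>2"
    by (auto dest: eventually_happens)
  then have "(1 - 1/2) * 2 powr (real n * (?h - 1/2)) \<le> real (card (codebook n (1/2)))"
    by (intro card_codebook_ge) auto
  also have "\<dots> \<le> real ((2 ^ n) ^ m)" using card_codebook_le of_nat_le_iff by blast
  also have "\<dots> = 2 powr (real n * real m)"
    by (simp add: power_mult[symmetric] powr_realpow[symmetric])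
  finally have "2 powr (real n * (?h - 1/2) - 1) \<le> 2 powr (real n * real m)"
    by (simp add: powr_diff)
  then have "real n * (?h - 1/2) - 1 \<le> real n * real m" by simp
  then have "real n * ?h \<le> real n * (real m + 1/2) + 1" by (simp add: algebra_simps)
  \<comment> \<open>The additive \<open>1\<close> stems from the factor \<open>1 - 1/2\<close> in
    front of the power; it is absorbed because \<open>n\<close> is at least
    \<open>1\<close>.\<close>
  also have "\<dots> \<le> real n * (real m + 2)" using n by (simp add: algebra_simps)
  finally show ?thesis using n by (simp add: bits_entropy_def)
qed

lemma eventually_ex_encoder:
  assumes \<gamma>: "0 < \<gamma>" "\<gamma> < 1" and feasible: "bits_entropy m f W p + \<gamma> \<le> R_BMD m f W p" and \<delta>: "\<delta> > 0"
  shows "\<forall>\<^sub>F n in sequentially. \<exists>E. modified_sign_coding m f W n E \<and>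
    (1 / real n) * log 2 (real (num_amp E * num_sign E n)) \<ge> bits_entropy m f W p + \<gamma> - \<delta> \<and>
    error_prob m f W n E \<le> \<delta>"
proof -
  let ?h = "H (bit_vars m)"
  have equiv: "equivocation \<le> 1 - \<gamma>" using feasible by (simp add: R_BMD_eq bits_entropy_def)
  \<comment> \<open>\<tau> is the amount by which the sign fraction is lowered:
    \<open>\<gamma> / 2\<close> keeps the fraction positive, \<open>\<delta> / 4\<close> bounds the
    loss of rate.\<close>
  define \<tau> where "\<tau> = min (\<gamma> / 2) (\<delta> / 4)"
  have \<tau>: "0 < \<tau>" "\<tau> < \<gamma>" "\<tau> \<le> \<delta> / 4" using \<gamma> \<delta> by (auto simp: \<tau>_def)
  \<comment> \<open>\<open>\<delta> / 4\<close> limits both the loss of rate and the no-match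
    probability, \<open>1/2\<close> makes \<open>1 - \<epsilon>\<close> cost at most one bit, and
    the last term keeps the slack \<open>2 * (m + 1) * \<epsilon>\<close> of the match count below
    \<open>\<tau> / 2\<close>.\<close>
  define \<epsilon> where "\<epsilon> = min (min (\<delta> / 4) (1/2)) (\<tau> / (4 * (real m + 1)))"
  have "0 < \<epsilon>" using \<delta> \<tau> by (simp add: \<epsilon>_def)
  moreover have "\<epsilon> \<le> \<delta> / 4" "\<epsilon> \<le> 1/2" unfolding \<epsilon>_def by linarith+
  ultimately have \<epsilon>: "0 < \<epsilon>" "\<epsilon> \<le> \<delta> / 4" "\<epsilon> \<le> 1/2" by blast+
  have "\<epsilon> \<le> \<tau> / (4 * (real m + 1))" by (simp add: \<epsilon>_def)
  then have \<epsilon>\<tau>: "2 * (real m + 1) * \<epsilon> \<le> \<tau> / 2" by (simp add: field_simps)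
  have "(\<lambda>n. (2 powr (- \<tau> / 2)) ^ n) \<longlonglongrightarrow> 0"
    using \<tau>(1) by (intro LIMSEQ_realpow_zero) (auto simp: powr_less_one)
  then have "\<forall>\<^sub>F n in sequentially. (2 powr (- \<tau> / 2)) ^ n < \<delta> / 2"
    using \<delta> by (intro order_tendstoD(2)) auto
  \<comment> \<open>The first bound ensures at least one information sign. The second makes
    \<open>\<delta> / 2 * n\<close> at least two bits: one for the factor
    \<open>1 - \<epsilon>\<close>, one for rounding down \<open>n1\<close>.\<close>
  moreover have "\<forall>\<^sub>F n in sequentially. real n \<ge> max (1 / (\<gamma> - \<tau>)) (4 / \<delta>)"
    by (rule filterlim_at_top[THEN iffD1, rule_format, OF filterlim_real_sequentially])
  ultimately show ?thesis
    using eventually_gt_at_top[of 0] eventually_typical[OF \<epsilon>(1)]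
  proof eventually_elim
    case (elim n)
    define n1 where "n1 = nat \<lfloor>(\<gamma> - \<tau>) * real n\<rfloor>"
    have n: "n > 0" "1 \<le> (\<gamma> - \<tau>) * real n" "4 \<le> \<delta> * real n"
      using elim(2,3) \<tau> \<delta> by (auto simp: field_simps)
    have n1: "real n1 \<le> (\<gamma> - \<tau>) * real n" "(\<gamma> - \<tau>) * real n - 1 \<le> real n1" "n1 > 0"
      using n(2) unfolding n1_def by linarith+
    have "(\<gamma> - \<tau>) * real n \<le> real n" using \<gamma> \<tau> by (intro mult_left_le_one_le) auto
    then have "real n1 \<le> real n" using n1(1) by simp
    then have "n1 \<le> n" by simp
    let ?N = "real (card (codebook n \<epsilon>))"
    have "(1/2) * 2 powr (real n * (?h - \<epsilon>)) \<le> (1 - \<epsilon>) * 2 powr (real n * (?h - \<epsilon>))"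
      using \<epsilon> by (intro mult_right_mono) auto
    also have "\<dots> \<le> ?N"
      using \<epsilon> n(1) elim(4) by (intro card_codebook_ge) auto
    finally have N: "2 powr (real n * (?h - \<epsilon>) - 1) \<le> ?N" by (simp add: powr_diff)
    then have "0 < ?N" by (rule less_le_trans[rotated]) simp
    then have "codebook n \<epsilon> \<noteq> {}" by auto
    then obtain E where E: "modified_sign_coding m f W n E" and num: "num_amp E = card (codebook n \<epsilon>)" "num_sign E n = 2 ^ n1"
      and err: "error_prob m f W n E \<le> \<epsilon> + 2 powr (real n * (equivocation + 2 * (real m + 1) * \<epsilon>)) / 2 ^ (n - n1)"
      using ex_encoder[OF n(1) \<epsilon>(1), of "\<gamma> - \<tau>" n1] \<gamma> \<tau> n1 by (auto simp: n1_def)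
    have "real n * (?h - \<epsilon>) - 1 \<le> log 2 ?N"
      using N \<open>0 < ?N\<close> by (simp add: le_log_iff)
    then have "real n * (?h - \<epsilon>) - 1 + real n1 \<le> log 2 (real (num_amp E * num_sign E n))"
      using \<open>0 < ?N\<close> by (simp add: num log_mult log_nat_power)
    moreover have "real n * (?h + \<gamma> - \<delta>) \<le> real n * (?h - \<epsilon>) - 1 + real n1"
    proof -
      have "real n * (?h + \<gamma> - \<delta>) = real n * (?h - \<epsilon>) + (\<gamma> - \<tau>) * real n + real n * (\<epsilon> + \<tau> - \<delta>)"
        by (simp add: algebra_simps)
      moreover have "real n * (\<epsilon> + \<tau> - \<delta>) \<le> real n * (- \<delta> / 2)"
        using \<epsilon>(2) \<tau>(3) by (intro mult_left_mono) auto
      ultimately show ?thesis using n1(2) n(3) by (simp add: algebra_simps)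
    qed
    ultimately have rate: "?h + \<gamma> - \<delta> \<le> (1 / real n) * log 2 (real (num_amp E * num_sign E n))"
      using n(1) by (simp add: field_simps)
    \<comment> \<open>Per symbol, \<open>1 - \<gamma> + \<tau> / 2\<close> bounds the match exponent
      while the second sign part supplies at least \<open>1 - \<gamma> + \<tau>\<close>.\<close>
    have "real n * (equivocation + 2 * (real m + 1) * \<epsilon>) - real (n - n1) \<le> - \<tau> / 2 * real n"
    proof -
      have "real n * (equivocation + 2 * (real m + 1) * \<epsilon>) \<le> real n * (1 - \<gamma> + \<tau> / 2)"
        using equiv \<epsilon>\<tau> by (intro mult_left_mono) auto
      then show ?thesis using n1(1) \<open>n1 \<le> n\<close> by (simp add: algebra_simps of_nat_diff)
    qed
    then have "2 powr (real n * (equivocation + 2 * (real m + 1) * \<epsilon>) - real (n - n1)) \<le> 2 powr (- \<tau> / 2 * real n)"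
      by simp
    also have "\<dots> = (2 powr (- \<tau> / 2)) ^ n" by (subst powr_powr[symmetric]) (simp add: powr_realpow)
    finally have "2 powr (real n * (equivocation + 2 * (real m + 1) * \<epsilon>)) / 2 ^ (n - n1)
        \<le> (2 powr (- \<tau> / 2)) ^ n"
      by (simp add: powr_diff powr_realpow)
    then have "2 powr (real n * (equivocation + 2 * (real m + 1) * \<epsilon>)) / 2 ^ (n - n1) \<le> \<delta> / 2"
      using elim(1) by linarith
    then have "error_prob m f W n E \<le> \<delta>" using err \<epsilon>(2) \<delta> by linarith
    with E rate show ?case by (auto simp: bits_entropy_def)
  qed
qed

end

theorem theorem4:
  fixes W :: "int \<Rightarrow> 'y::countable pmf"
    and f :: "bool list \<Rightarrow> int"
    and m M :: nat
  assumes "m \<ge> 1" and "M = 2 ^ (m + 1)"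
    and "bij_betw f (labels m) (amplitudes M)"
    and "\<And>p J. set_pmf p \<subseteq> labels m \<Longrightarrow> J \<subseteq> all_vars m \<Longrightarrow> J \<noteq> {} \<Longrightarrow>
           finite_joint_entropy (source_channel_law f W p) rv J"
    and "feasible m f W \<noteq> {}"
  shows "achievable m f W (R_BMD_gamma_pos m f W)"
  unfolding achievable_def
proof (intro allI impI)
  fix \<delta> :: real assume \<delta>: "\<delta> > 0"
  let ?r = "\<lambda>(p, \<gamma>). bits_entropy m f W p + \<gamma>"
  have channel: "bit_channel m f W p" if "(p, \<gamma>) \<in> feasible m f W" for p \<gamma>
    using that assms by unfold_locales (auto simp: feasible_def)
  have "bdd_above (?r ` feasible m f W)"
  proof (rule bdd_aboveI2)
    fix c assume c: "c \<in> feasible m f W"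
    obtain p \<gamma> where c_eq: "c = (p, \<gamma>)" by (cases c)
    have "bits_entropy m f W p \<le> real m + 2"
      using c c_eq by (intro bit_channel.bits_entropy_le channel) auto
    then show "?r c \<le> real m + 3" using c c_eq by (auto simp: feasible_def)
  qed
  \<comment> \<open>The supremum need not be attained, so half of \<delta> is spent on picking a
    feasible point close to it and the other half on coding at that point.\<close>
  moreover have "R_BMD_gamma_pos m f W - \<delta> / 2 < R_BMD_gamma_pos m f W" using \<delta> by simp
  ultimately obtain c where c: "c \<in> feasible m f W" and "R_BMD_gamma_pos m f W - \<delta> / 2 < ?r c"
    unfolding R_BMD_gamma_pos_def using less_cSUP_iff[OF assms(5)] by blast
  then obtain p \<gamma> where p: "(p, \<gamma>) \<in> feasible m f W"
    and r: "R_BMD_gamma_pos m f W - \<delta> / 2 < bits_entropy m f W p + \<gamma>"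
    by (cases c) auto
  have "\<forall>\<^sub>F n in sequentially. \<exists>E. modified_sign_coding m f W n E \<and>
    (1 / real n) * log 2 (real (num_amp E * num_sign E n)) \<ge> bits_entropy m f W p + \<gamma> - \<delta> / 2 \<and>
    error_prob m f W n E \<le> \<delta> / 2"
    using p \<delta> by (intro bit_channel.eventually_ex_encoder[OF channel[OF p]]) (auto simp: feasible_def)
  then show "\<forall>\<^sub>F n in sequentially. \<exists>E. modified_sign_coding m f W n E \<and>
    (1 / real n) * log 2 (real (num_amp E * num_sign E n)) \<ge> R_BMD_gamma_pos m f W - \<delta> \<and>
    error_prob m f W n E \<le> \<delta>"
  proof eventually_elim
    case (elim n)
    then obtain E where "modified_sign_coding m f W n E"
      "(1 / real n) * log 2 (real (num_amp E * num_sign E n)) \<ge> bits_entropy m f W p + \<gamma> - \<delta> / 2"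
      "error_prob m f W n E \<le> \<delta> / 2" by blast
    then show ?case using r \<delta> by (intro exI[of _ E]) linarith
  qed
qed

end
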